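(* Let $G$ be a bipartite graph on $2n$ vertices which is the union of three disjoint perfect matchings $M_1$, $M_2$, and $M_3$. Then, for any integers $a_1,a_2,a_3\ge 0$ satisfying $a_1+a_2+a_3=n-1$, the graph $G$ contains an $(a_1,a_2,a_3)$-matching.
   Context: Graphs are finite and simple. "Disjoint" matchings means pairwise edge-disjoint, and "union" means $E(G)=M_1\cup M_2\cup M_3$, where each $M_i$ is a perfect matching of $G$. For integers $a_1,a_2,a_3\ge 0$, a matching $M$ of $G$ is called an $(a_1,a_2,a_3)$-matching if $|M\cap M_i|=a_i$ for every $i\in\{1,2,3\}$. *)

theory Defs
  imports Main
begin

text \<open>
  A graph is given by its vertex set \<open>V\<close> and its edge set \<open>E\<close>; an edge is the
  two-element set of its endpoints, so that a matching is a set of edges and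
  cardinalities of matchings count undirected edges once.
\<close>

definition simple_graph :: "'a set \<Rightarrow> 'a set set \<Rightarrow> bool" where
  "simple_graph V E \<longleftrightarrow> finite V \<and> (\<forall>e\<in>E. e \<subseteq> V \<and> card e = 2)"

definition bipartite :: "'a set \<Rightarrow> 'a set set \<Rightarrow> bool" where
  "bipartite V E \<longleftrightarrow>
     (\<exists>A B. A \<union> B = V \<and> A \<inter> B = {} \<and> (\<forall>e\<in>E. \<exists>a\<in>A. \<exists>b\<in>B. e = {a, b}))"

definition matching :: "'a set set \<Rightarrow> 'a set set \<Rightarrow> bool" where
  "matching E M \<longleftrightarrow> M \<subseteq> E \<and> pairwise disjnt M"

definition perfect_matching :: "'a set \<Rightarrow> 'a set set \<Rightarrow> 'a set set \<Rightarrow> bool" where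
  "perfect_matching V E M \<longleftrightarrow> matching E M \<and> \<Union>M = V"

definition typed_matching ::
  "'a set set \<Rightarrow> 'a set set \<Rightarrow> 'a set set \<Rightarrow> 'a set set \<Rightarrow> nat \<Rightarrow> nat \<Rightarrow> nat \<Rightarrow> 'a set set \<Rightarrow> bool"
where
  \<comment> \<open>\<open>M\<close> is an \<open>(a1, a2, a3)\<close>-matching with respect to \<open>M1, M2, M3\<close>.\<close>
  "typed_matching E M1 M2 M3 a1 a2 a3 M \<longleftrightarrow>
     matching E M \<and> card (M \<inter> M1) = a1 \<and> card (M \<inter> M2) = a2 \<and> card (M \<inter> M3) = a3"

end

theory Submission
  imports Defs Complex_Main "HOL-Combinatorics.Cycles"
begin

text \<open>
  Suppose that no matching with \<open>n - 1\<close> edges has the color vector \<open>b\<close>. Such matchings with one edge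
  exchanged have adjacent vectors in the triangular lattice, so a walk of exchanges has a signed
  number of crossings of a lattice ray issuing from \<open>b\<close>, and exchanges in disjoint places can be
  commuted without changing it. For a perfect matching \<open>x\<close> and an alternating cycle \<open>C\<close>, pushing a gap
  once around \<open>C\<close> turns \<open>x\<close> into \<open>x \<triangle> C\<close>; the crossing number of this walk does not depend on where the
  gap starts. It is additive over the three cycles of a theta graph, and in a connected graph it
  commutes for two disjoint cycles, because the gap can travel along a path between them. By
  the cycle lemma it vanishes if \<open>x\<close> and \<open>x \<triangle> C\<close> both have at most, or both more than, \<open>b 0\<close> edges of
  color \<open>0\<close>.

  Consider pairs \<open>(x, x \<triangle> C)\<close> on different sides of this threshold. As long as color \<open>k\<close> (\<open>k = 1, 2\<close>) is
  used, a linear programming argument gives a theta graph or a pair of disjoint cycles through which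
  the pair can be moved so as to use color \<open>k\<close> less at the threshold, with the same
  crossing number. At the end of this descent color \<open>k\<close> is unused and the number for the ray in
  direction \<open>k\<close> is \<open>0\<close>; but the numbers for the two opposite rays \<open>k = 1\<close> and \<open>k = 2\<close> add up to \<open>1\<close>.

  If the graph is disconnected, the same descent with a Sperner labelling instead of crossing numbers
  yields a perfect matching of the smaller part with at most \<open>b i\<close> edges of color \<open>i\<close>, and
  the rest is supplied by induction on the other part.
\<close>

section \<open>Near-perfect matchings as colorings\<close>

definition color_count :: "'a set \<Rightarrow> ('a \<Rightarrow> nat) \<Rightarrow> nat \<Rightarrow> int" where
  "color_count A f i = (\<Sum>a\<in>A. of_bool (f a = i))"

lemma color_count_upd:
  assumes "finite A" "a \<in> A"
  shows "color_count A (f(a := j)) i = color_count A f i + of_bool (j = i) - of_bool (f a = i)"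
proof -
  have "(\<Sum>x\<in>A - {a}. of_bool ((f(a := j)) x = i)) = (\<Sum>x\<in>A - {a}. of_bool (f x = i) :: int)"
    by (rule sum.cong) auto
  then show ?thesis
    using assms unfolding color_count_def by (simp add: sum.remove[OF assms])
qed

lemma color_count_nonneg: "0 \<le> color_count A f i"
  unfolding color_count_def by (rule sum_nonneg) auto

lemma color_count_card: "finite A \<Longrightarrow> color_count A f i = int (card {a \<in> A. f a = i})"
  unfolding color_count_def by (simp add: Int_def of_bool_def sum.If_cases)

text \<open>\<open>R\<close> is the indicator of the ray, and a pair such as \<open>(a0, ak)\<close>
  is the unit vector of a color in the coordinates for colors \<open>0\<close> and \<open>k\<close>,
  with \<open>(0, 0)\<close> for the third color. Two exchanges made in either order bound a closed
  walk of four lattice steps, too short to go round a point that it does not visit.\<close>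

lemma square_arith:
  fixes R :: "int \<Rightarrow> int \<Rightarrow> int" and x y t s a0 ak b0 bk c0 ck d0 dk :: int
  assumes R: "\<And>x y. R x y = (if x = t \<and> s < y then 1 else 0)"
    and W: "(a0,ak) \<in> {(1,0),(0,1),(0,0)}" "(b0,bk) \<in> {(1,0),(0,1),(0,0)}"
       "(c0,ck) \<in> {(1,0),(0,1),(0,0)}" "(d0,dk) \<in> {(1,0),(0,1),(0,0)}"
    and "x = t \<Longrightarrow> y \<noteq> s"
    and "x + a0 - b0 = t \<Longrightarrow> y + ak - bk \<noteq> s"
    and "x + c0 - d0 = t \<Longrightarrow> y + ck - dk \<noteq> s"
    and "x + a0 - b0 + c0 - d0 = t \<Longrightarrow> y + ak - bk + ck - dk \<noteq> s"
  shows "R x y * a0 - R (x + a0 - b0) (y + ak - bk) * b0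
    + (R (x + a0 - b0) (y + ak - bk) * c0 - R (x + a0 - b0 + c0 - d0) (y + ak - bk + ck - dk) * d0)
   = R x y * c0 - R (x + c0 - d0) (y + ck - dk) * d0
    + (R (x + c0 - d0) (y + ck - dk) * a0 - R (x + a0 - b0 + c0 - d0) (y + ak - bk + ck - dk) * b0)"
  using W assms(6-9)
  by (simp only: insert_iff empty_iff prod.inject simp_thms)
    (elim disjE conjE; simp only: R; simp; presburger?)
text \<open>The boundary of the triangle whose corners arise from one vector \<open>(x, y)\<close>
  by adding one edge of each of three colors. No lattice point lies inside, so the crossings
  cancel.\<close>

lemma triangle_arith:
  fixes R :: "int \<Rightarrow> int \<Rightarrow> int" and x y t s a0 ak b0 bk c0 ck :: int
  assumes R: "\<And>x y. R x y = (if x = t \<and> s < y then 1 else 0)"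
    and W: "(a0,ak) \<in> {(1,0),(0,1),(0,0)}" "(b0,bk) \<in> {(1,0),(0,1),(0,0)}"
       "(c0,ck) \<in> {(1,0),(0,1),(0,0)}"
    and "x + a0 = t \<Longrightarrow> y + ak \<noteq> s" "x + b0 = t \<Longrightarrow> y + bk \<noteq> s" "x + c0 = t \<Longrightarrow> y + ck \<noteq> s"
  shows "R (x + a0) (y + ak) * (c0 - b0) + R (x + b0) (y + bk) * (a0 - c0)
    + R (x + c0) (y + ck) * (b0 - a0) = 0"
  using W assms(5-7)
  by (simp only: insert_iff empty_iff prod.inject simp_thms)
    (elim disjE conjE; simp only: R; simp; presburger?)

lemma bij_betw_remove_point:
  assumes "bij_betw g X Y" "a \<in> X"
  shows "bij_betw g (X - {a}) (Y - {g a})"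
  using assms unfolding bij_betw_def inj_on_def by (auto simp: image_iff)

lemma bij_betw_insert_point:
  assumes "bij_betw g (X - {a}) (Y - {v})" "a \<in> X" "v \<in> Y" "g a = v"
  shows "bij_betw g X Y"
proof -
  have "bij_betw g ((X - {a}) \<union> {a}) ((Y - {v}) \<union> {g a})"
    by (rule notIn_Un_bij_betw) (use assms in auto)
  moreover have "(X - {a}) \<union> {a} = X" "(Y - {v}) \<union> {g a} = Y" using assms by auto
  ultimately show ?thesis by simp
qed

text \<open>The map \<open>p i\<close> sends a vertex of \<open>A\<close> to its partner in the
  matching of color \<open>i\<close>; an edge is thus a vertex of \<open>A\<close> together with a
  color.\<close>

locale three_matchings =
  fixes A :: "'a set" and B :: "'b set" and p :: "nat \<Rightarrow> 'a \<Rightarrow> 'b"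
  assumes fin: "finite A" and bij: "\<And>i. i < 3 \<Longrightarrow> bij_betw (p i) A B"
begin

text \<open>
  A matching is encoded by the color of the edge at each vertex of \<open>A\<close>; color \<open>3\<close> marks an uncovered
  vertex. In \<open>near_perfect f u v\<close> the vertices \<open>u\<close> and \<open>v\<close> are the uncovered ones. Values outside \<open>A\<close> are irrelevant.
\<close>

definition perfect :: "('a \<Rightarrow> nat) \<Rightarrow> bool" where
  "perfect x \<longleftrightarrow> (\<forall>a\<in>A. x a < 3) \<and> bij_betw (\<lambda>a. p (x a) a) A B"

definition near_perfect :: "('a \<Rightarrow> nat) \<Rightarrow> 'a \<Rightarrow> 'b \<Rightarrow> bool" where
  "near_perfect f u v \<longleftrightarrow> u \<in> A \<and> v \<in> B \<and> f u = 3 \<and> (\<forall>a\<in>A - {u}. f a < 3)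
     \<and> bij_betw (\<lambda>a. p (f a) a) (A - {u}) (B - {v})"

abbreviation "ct \<equiv> color_count A"

lemma ct_upd: "a \<in> A \<Longrightarrow> ct (f(a := j)) i = ct f i + of_bool (j = i) - of_bool (f a = i)"
  using color_count_upd[OF fin] .

lemma perfect_const: "i < 3 \<Longrightarrow> perfect (\<lambda>_. i)"
  using bij unfolding perfect_def by simp

lemma p_mem: "i < 3 \<Longrightarrow> a \<in> A \<Longrightarrow> p i a \<in> B"
  using bij bij_betwE by blast

lemma near_perfect_remove:
  assumes "perfect x" "h \<in> A"
  shows "near_perfect (x(h := 3)) h (p (x h) h)"
proof -
  have "bij_betw (\<lambda>a. p (x a) a) (A - {h}) (B - {p (x h) h})"
    using assms bij_betw_remove_point unfolding perfect_def by fastforce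
  then have "bij_betw (\<lambda>a. p ((x(h := 3)) a) a) (A - {h}) (B - {p (x h) h})"
    by (rule bij_betw_cong[THEN iffD1, rotated]) auto
  then show ?thesis
    using assms p_mem unfolding near_perfect_def perfect_def by auto
qed

lemma near_perfect_B_slide:
  assumes "near_perfect f u v" "a \<in> A" "a \<noteq> u" "j < 3" "p j a = v"
  shows "near_perfect (f(a := j)) u (p (f a) a)"
proof -
  let ?g = "\<lambda>a. p (f a) a"
  let ?h = "\<lambda>b. p ((f(a := j)) b) b"
  have s: "u \<in> A" "v \<in> B" "f u = 3" "\<forall>a\<in>A - {u}. f a < 3" "bij_betw ?g (A - {u}) (B - {v})"
    using assms(1) unfolding near_perfect_def by auto
  have "?g a \<in> B - {v}" using s(5) assms(2,3) bij_betwE by blast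
  have "bij_betw ?g (A - {u} - {a}) (B - {v} - {?g a})"
    by (rule bij_betw_remove_point[OF s(5)]) (use assms in auto)
  then have "bij_betw ?h (A - {u} - {a}) (B - {v} - {?g a})"
    by (rule bij_betw_cong[THEN iffD1, rotated]) auto
  moreover have "B - {v} - {?g a} = B - {?g a} - {v}" by auto
  ultimately have "bij_betw ?h (A - {u} - {a}) (B - {?g a} - {v})" by simp
  then have "bij_betw ?h (A - {u}) (B - {?g a})"
    by (rule bij_betw_insert_point) (use assms s \<open>?g a \<in> B - {v}\<close> in auto)
  then show ?thesis using s assms \<open>?g a \<in> B - {v}\<close> unfolding near_perfect_def by auto
qed

lemma near_perfect_A_slide:
  assumes "near_perfect f u v" "u' \<in> A" "u' \<noteq> u" "j < 3" "p (f u') u' = p j u"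
  shows "near_perfect (f(u := j, u' := 3)) u' v"
proof -
  let ?g = "\<lambda>a. p (f a) a"
  let ?h = "\<lambda>b. p ((f(u := j, u' := 3)) b) b"
  have s: "u \<in> A" "v \<in> B" "f u = 3" "\<forall>a\<in>A - {u}. f a < 3" "bij_betw ?g (A - {u}) (B - {v})"
    using assms(1) unfolding near_perfect_def by auto
  have gu: "?g u' \<in> B - {v}" using s(5) assms(2,3) bij_betwE by blast
  have "bij_betw ?g (A - {u} - {u'}) (B - {v} - {?g u'})"
    by (rule bij_betw_remove_point[OF s(5)]) (use assms in auto)
  then have "bij_betw ?h (A - {u} - {u'}) (B - {v} - {?g u'})"
    by (rule bij_betw_cong[THEN iffD1, rotated]) auto
  moreover have "A - {u} - {u'} = A - {u'} - {u}" by auto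
  ultimately have "bij_betw ?h (A - {u'} - {u}) (B - {v} - {?g u'})" by simp
  then have "bij_betw ?h (A - {u'}) (B - {v})"
    by (rule bij_betw_insert_point) (use assms s gu in auto)
  then show ?thesis using s assms unfolding near_perfect_def by auto
qed

lemma color_count_sum:
  assumes "finite X" "\<forall>a\<in>X. f a < (3::nat)"
  shows "color_count X f 0 + color_count X f 1 + color_count X f 2 = int (card X)"
proof -
  have "color_count X f 0 + color_count X f 1 + color_count X f 2
      = (\<Sum>a\<in>X. of_bool (f a = 0) + of_bool (f a = 1) + of_bool (f a = 2))"
    unfolding color_count_def by (simp add: sum.distrib)
  also have "\<dots> = (\<Sum>a\<in>X. 1)"
  proof (rule sum.cong)
    fix a assume "a \<in> X"
    then have "f a = 0 \<or> f a = 1 \<or> f a = 2" using assms(2) by force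
    then show "of_bool (f a = 0) + of_bool (f a = 1) + of_bool (f a = 2) = (1::int)" by auto
  qed simp
  finally show ?thesis by simp
qed

lemma perfect_sum: "perfect x \<Longrightarrow> ct x 0 + ct x 1 + ct x 2 = int (card A)"
  using color_count_sum[OF fin] unfolding perfect_def by blast

lemma near_perfect_sum:
  assumes "near_perfect f u v"
  shows "ct f 0 + ct f 1 + ct f 2 = int (card A) - 1"
proof -
  have u: "u \<in> A" "f u = 3" using assms unfolding near_perfect_def by auto
  have "\<forall>a\<in>A. (f(u := 0)) a < 3" using assms unfolding near_perfect_def by auto
  have "ct (f(u := 0)) 0 + ct (f(u := 0)) 1 + ct (f(u := 0)) 2 = int (card A)"
    by (rule color_count_sum[OF fin \<open>\<forall>a\<in>A. (f(u := 0)) a < 3\<close>])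
  then show ?thesis unfolding ct_upd[OF u(1)] using u(2) by simp
qed

end

text \<open>
  Instances of induction hypotheses contain eta-expanded updates, which \<open>fun_upd_apply\<close> would unfold under the binder.
\<close>

declare fun_upd_apply [simp del] fun_upd_same [simp] fun_upd_other [simp]

context three_matchings
begin

text \<open>
  In a B-walk the gap in \<open>A\<close> stays fixed: each step \<open>(a, j)\<close> covers the current gap \<open>v\<close> in \<open>B\<close> by the edge of color
  \<open>j\<close> at \<open>a\<close>, which frees the old partner of \<open>a\<close>. In an A-walk the gap in \<open>B\<close> stays fixed and the gap in \<open>A\<close>
  runs through the list.
\<close>

fun B_walk :: "('a \<Rightarrow> nat) \<Rightarrow> 'b \<Rightarrow> ('a \<times> nat) list \<Rightarrow> bool" where
  "B_walk f v [] = True"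
| "B_walk f v ((a, j) # os) = (a \<in> A \<and> f a < 3 \<and> j < 3 \<and> p j a = v \<and> B_walk (f(a := j)) (p (f a) a) os)"

fun B_walk_end :: "('a \<Rightarrow> nat) \<Rightarrow> ('a \<times> nat) list \<Rightarrow> 'a \<Rightarrow> nat" where
  "B_walk_end f [] = f"
| "B_walk_end f ((a, j) # os) = B_walk_end (f(a := j)) os"

fun B_walk_gap :: "('a \<Rightarrow> nat) \<Rightarrow> 'b \<Rightarrow> ('a \<times> nat) list \<Rightarrow> 'b" where
  "B_walk_gap f v [] = v"
| "B_walk_gap f v ((a, j) # os) = B_walk_gap (f(a := j)) (p (f a) a) os"

fun A_walk :: "('a \<Rightarrow> nat) \<Rightarrow> ('a \<Rightarrow> nat) \<Rightarrow> 'a list \<Rightarrow> bool" where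
  "A_walk f y (a # a' # as) = (a' \<in> A \<and> a' \<noteq> a \<and> y a < 3 \<and> p (f a') a' = p (y a) a
     \<and> A_walk (f(a := y a, a' := 3)) y (a' # as))"
| "A_walk f y _ = True"

fun A_walk_end :: "('a \<Rightarrow> nat) \<Rightarrow> ('a \<Rightarrow> nat) \<Rightarrow> 'a list \<Rightarrow> 'a \<Rightarrow> nat" where
  "A_walk_end f y (a # a' # as) = A_walk_end (f(a := y a, a' := 3)) y (a' # as)"
| "A_walk_end f y _ = f"

lemma B_walk_near_perfect: "near_perfect f u v \<Longrightarrow> B_walk f v os \<Longrightarrow> near_perfect (B_walk_end f os) u (B_walk_gap f v os)"
proof (induction os arbitrary: f v)
  case (Cons o1 os)
  obtain a j where o1: "o1 = (a, j)" by fastforce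
  have "a \<noteq> u" using Cons.prems o1 unfolding near_perfect_def by auto
  then have "near_perfect (f(a := j)) u (p (f a) a)"
    using Cons.prems o1 near_perfect_B_slide by simp
  then show ?case using Cons.IH Cons.prems o1 by simp
qed simp

lemma B_walk_end_other: "a \<notin> fst ` set os \<Longrightarrow> B_walk_end f os a = f a"
  by (induction os arbitrary: f) (auto simp: fun_upd_twist)

lemma B_walk_end_append: "B_walk_end f (os @ os') = B_walk_end (B_walk_end f os) os'"
  by (induction os arbitrary: f) (auto simp: fun_upd_twist)

lemma B_walk_gap_append: "B_walk_gap f v (os @ os') = B_walk_gap (B_walk_end f os) (B_walk_gap f v os) os'"
  by (induction os arbitrary: f v) (auto simp: fun_upd_twist)

lemma B_walk_append: "B_walk f v (os @ os') \<longleftrightarrow> B_walk f v os \<and> B_walk (B_walk_end f os) (B_walk_gap f v os) os'"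
  by (induction os arbitrary: f v) (auto simp: fun_upd_twist)

lemma B_walk_end_map: "B_walk_end f (map (\<lambda>a. (a, y a)) as) = (\<lambda>a. if a \<in> set as then y a else f a)"
  by (induction as arbitrary: f) (auto simp: fun_eq_iff fun_upd_apply)

lemma B_walk_upd: "c \<notin> fst ` set os \<Longrightarrow> B_walk (f(c := i)) v os \<longleftrightarrow> B_walk f v os"
  by (induction os arbitrary: f v) (auto simp: fun_upd_twist)

lemma B_walk_end_upd: "c \<notin> fst ` set os \<Longrightarrow> B_walk_end (f(c := i)) os = (B_walk_end f os)(c := i)"
  by (induction os arbitrary: f) (auto simp: fun_upd_twist)

end

section \<open>Crossing numbers\<close>

text \<open>
  The target has \<open>t\<close> edges of color \<open>0\<close> and \<open>s\<close> of color \<open>k\<close>; this determines the third color.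
\<close>

locale unhit = three_matchings A B p
  for A :: "'a set" and B :: "'b set" and p :: "nat \<Rightarrow> 'a \<Rightarrow> 'b" +
  fixes t s :: int and k :: nat
  assumes k0: "k \<noteq> 0" and s0: "0 \<le> s"
    and unhit: "\<And>f u v. near_perfect f u v \<Longrightarrow> ct f 0 = t \<Longrightarrow> ct f k \<noteq> s"
begin

text \<open>
  The ray from the target in direction \<open>k\<close>, inside the line of vectors with \<open>t\<close> edges of color \<open>0\<close>. It is crossed
  when an edge of color \<open>0\<close> is added at a matching on the ray.
\<close>

definition right_of :: "('a \<Rightarrow> nat) \<Rightarrow> int" where
  "right_of f = of_bool (ct f 0 = t \<and> s < ct f k)"

abbreviation lvl :: "nat \<Rightarrow> int" where "lvl j \<equiv> of_bool (j = 0)"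

text \<open>An exchange is split into two halves: an edge of color \<open>j\<close> is added to
  \<open>f\<close>, then one of color \<open>i\<close> is removed to give \<open>f'\<close>. The ray
  is met in a half only if the edge concerned has color \<open>0\<close>, with opposite signs for
  adding and removing.\<close>

definition step :: "('a \<Rightarrow> nat) \<Rightarrow> ('a \<Rightarrow> nat) \<Rightarrow> nat \<Rightarrow> nat \<Rightarrow> int" where
  "step f f' j i = right_of f * lvl j - right_of f' * lvl i"

text \<open>The crossing number is a closed 1-form on the lattice with the target removed.\<close>

lemma square_closed:
  assumes "near_perfect f u v" "near_perfect fa ua va" "near_perfect fb ub vb" "near_perfect fab uab vab"
    and "\<And>l. ct fa l = ct f l + of_bool (j = l) - of_bool (i = l)"
    and "\<And>l. ct fb l = ct f l + of_bool (j' = l) - of_bool (i' = l)"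
    and "\<And>l. ct fab l = ct fa l + of_bool (j' = l) - of_bool (i' = l)"
  shows "step f fa j i + step fa fab j' i' = step f fb j' i' + step fb fab j i"
proof -
  note un = unhit[OF assms(1)] unhit[OF assms(2)] unhit[OF assms(3)] unhit[OF assms(4)]
  note c = assms(5)[of 0] assms(5)[of k] assms(6)[of 0] assms(6)[of k] assms(7)[of 0] assms(7)[of k]
  have W: "(lvl l, of_bool (l = k)) \<in> {(1, 0), (0, 1), (0, 0 :: int)}" for l
    using k0 by auto
  have region: "right_of g = (\<lambda>x y. if x = t \<and> s < y then 1 else 0) (ct g 0) (ct g k)" for g
    unfolding right_of_def by simp
  show ?thesis
    unfolding step_def region c
    by (rule square_arith[OF refl W W W W]) (use un in \<open>simp_all add: c algebra_simps\<close>)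
qed

lemma triangle_closed:
  assumes "near_perfect f1 u1 v1" "near_perfect f2 u2 v2" "near_perfect f3 u3 v3"
    and "\<And>l. ct f2 l = ct f1 l + of_bool (i2 = l) - of_bool (i1 = l)"
    and "\<And>l. ct f3 l = ct f1 l + of_bool (i3 = l) - of_bool (i1 = l)"
  shows "right_of f1 * (lvl i3 - lvl i2) + right_of f2 * (lvl i1 - lvl i3) + right_of f3 * (lvl i2 - lvl i1) = 0"
proof -
  note un = unhit[OF assms(1)] unhit[OF assms(2)] unhit[OF assms(3)]
  note c = assms(4)[of 0] assms(4)[of k] assms(5)[of 0] assms(5)[of k]
  have W: "(lvl l, of_bool (l = k)) \<in> {(1, 0), (0, 1), (0, 0 :: int)}" for l
    using k0 by auto
  have region: "right_of g = (\<lambda>x y. if x = t \<and> s < y then 1 else 0) (ct g 0) (ct g k)" for g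
    unfolding right_of_def by simp
  show ?thesis
    using triangle_arith[OF refl W[of i1] W[of i2] W[of i3], of "ct f1 0 - lvl i1" t "ct f1 k - of_bool (i1 = k)" s]
      un unfolding region c by (simp add: algebra_simps)
qed

end

section \<open>Alternating cycles, and walks of the two gaps along them\<close>

definition switch :: "('a \<Rightarrow> nat) \<Rightarrow> ('a \<Rightarrow> nat) \<Rightarrow> 'a set \<Rightarrow> 'a \<Rightarrow> nat" where
  "switch x y S = (\<lambda>a. if a \<in> S then y a else x a)"

lemma switch_empty [simp]: "switch x y {} = x"
  unfolding switch_def by simp

lemma switch_upd: "(switch x y S)(a := y a) = switch x y (insert a S)"
  unfolding switch_def by (auto simp: fun_upd_apply)

lemma switch_apply: "switch x y S a = (if a \<in> S then y a else x a)"
  unfolding switch_def by simp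

context three_matchings
begin

text \<open>
  In \<open>alt_cycle x y as\<close> the edge of \<open>y\<close> at each vertex of the cyclic list ends at the \<open>x\<close>-partner of the next one.
\<close>

definition arc :: "('a \<Rightarrow> nat) \<Rightarrow> ('a \<Rightarrow> nat) \<Rightarrow> 'a \<Rightarrow> 'a \<Rightarrow> bool" where
  "arc x y a a' \<longleftrightarrow> p (y a) a = p (x a') a'"

definition alt_cycle :: "('a \<Rightarrow> nat) \<Rightarrow> ('a \<Rightarrow> nat) \<Rightarrow> 'a list \<Rightarrow> bool" where
  "alt_cycle x y as \<longleftrightarrow> as \<noteq> [] \<and> distinct as \<and> set as \<subseteq> A \<and> successively (arc x y) (as @ [hd as])
     \<and> (\<forall>a\<in>set as. x a < 3 \<and> y a < 3) \<and> (\<forall>a. a \<notin> set as \<longrightarrow> y a = x a)"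

lemma arc_upd:
  "successively (arc x y) (b # bs) \<Longrightarrow> a \<notin> set bs \<Longrightarrow> successively (arc (x(a := i)) y) (b # bs)"
  by (induction bs arbitrary: b) (auto simp: arc_def)

lemma A_walk_path:
  assumes "distinct (a # as)" "set as \<subseteq> A" "\<forall>a\<in>set (butlast (a # as)). y a < 3"
    "successively (arc x y) (a # as)"
  shows "A_walk (x(a := 3)) y (a # as)"
  using assms
proof (induction as arbitrary: a x)
  case (Cons a' as)
  have "successively (arc (x(a := y a)) y) (a' # as)"
    using Cons.prems(1,4) by (auto intro!: arc_upd)
  then have "A_walk ((x(a := y a))(a' := 3)) y (a' # as)"
    using Cons.IH[of a' "x(a := y a)"] Cons.prems by simp
  then show ?case using Cons.prems by (auto simp: arc_def)
qed simp

lemma A_walk_end_path: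
  "distinct (as @ [h]) \<Longrightarrow> A_walk_end (x(hd (as @ [h]) := 3)) y (as @ [h]) = (switch x y (set as))(h := 3)"
proof (induction as arbitrary: x)
  case (Cons a as)
  obtain a' bs where e: "as @ [h] = a' # bs" by (cases "as @ [h]") auto
  have "A_walk_end (x(a := 3)) y (a # a' # bs) = A_walk_end ((x(a := y a))(a' := 3)) y (as @ [h])"
    using e by simp
  also have "\<dots> = (switch (x(a := y a)) y (set as))(h := 3)"
    using Cons.IH[of "x(a := y a)"] Cons.prems e by simp
  also have "\<dots> = (switch x y (set (a # as)))(h := 3)"
    using Cons.prems by (auto simp: switch_def fun_upd_apply)
  finally show ?case using e by simp
qed simp

end

context unhit
begin

fun B_walk_value :: "('a \<Rightarrow> nat) \<Rightarrow> ('a \<times> nat) list \<Rightarrow> int" where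
  "B_walk_value f [] = 0"
| "B_walk_value f ((a, j) # os) = step f (f(a := j)) j (f a) + B_walk_value (f(a := j)) os"

fun A_walk_value :: "('a \<Rightarrow> nat) \<Rightarrow> ('a \<Rightarrow> nat) \<Rightarrow> 'a list \<Rightarrow> int" where
  "A_walk_value f y (a # a' # as) = step f (f(a := y a, a' := 3)) (y a) (f a') + A_walk_value (f(a := y a, a' := 3)) y (a' # as)"
| "A_walk_value f y _ = 0"

text \<open>
  Recoloring the vertices of a cycle one by one; between two recolorings, \<open>g(a := 3)\<close> is the near-perfect matching.
\<close>

fun winding :: "('a \<Rightarrow> nat) \<Rightarrow> ('a \<Rightarrow> nat) \<Rightarrow> 'a list \<Rightarrow> int" where
  "winding g y [] = 0"
| "winding g y (a # as) = right_of (g(a := 3)) * (lvl (y a) - lvl (g a)) + winding (g(a := y a)) y as"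

lemma B_walk_value_append: "B_walk_value f (os @ os') = B_walk_value f os + B_walk_value (B_walk_end f os) os'"
  by (induction os arbitrary: f) auto

lemma step_rev: "step f' f i j = - step f f' j i"
  unfolding step_def by simp

text \<open>One slide of the gap in \<open>A\<close> is moved past the steps of the B-walk one at a
  time. Each passage is a square of exchanges in disjoint places, so \<open>square_closed\<close>
  applies.\<close>

lemma A_slide_B_walk:
  assumes "near_perfect f u v" "B_walk f v os" "u' \<in> A" "u' \<noteq> u" "j < 3" "p (f u') u' = p j u"
    "u' \<notin> fst ` set os"
  shows "step f (f(u := j, u' := 3)) j (f u') + B_walk_value (f(u := j, u' := 3)) os
    = B_walk_value f os + step (B_walk_end f os) ((B_walk_end f os)(u := j, u' := 3)) j (f u')"
  using assms
proof (induction os arbitrary: f v)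
  case (Cons o1 os)
  obtain c i where o1: "o1 = (c, i)" by fastforce
  let ?f1 = "f(c := i)" and ?fA = "f(u := j, u' := 3)"
  have c: "c \<in> A" "f c < 3" "i < 3" "p i c = v" "B_walk ?f1 (p (f c) c) os"
    using Cons.prems(2) o1 by auto
  have u: "u \<in> A" "f u = 3" using Cons.prems(1) unfolding near_perfect_def by auto
  have cu: "c \<noteq> u" "c \<noteq> u'" using c u Cons.prems(7) o1 by auto
  have s1: "near_perfect ?f1 u (p (f c) c)" using near_perfect_B_slide[OF Cons.prems(1) c(1) cu(1) c(3,4)] .
  have sA: "near_perfect ?fA u' v" using near_perfect_A_slide[OF Cons.prems(1,3-6)] .
  have f1u: "?f1 u' = f u'" using cu by simp
  have sAB: "near_perfect (?f1(u := j, u' := 3)) u' (p (f c) c)"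
    by (rule near_perfect_A_slide[OF s1 Cons.prems(3-5)]) (use Cons.prems(6) f1u in simp)
  have eAB: "?f1(u := j, u' := 3) = ?fA(c := i)" using cu by (simp add: fun_upd_twist)
  have sq: "step f ?fA j (f u') + step ?fA (?fA(c := i)) i (f c)
      = step f ?f1 i (f c) + step ?f1 (?fA(c := i)) j (f u')"
  proof (rule square_closed[OF Cons.prems(1) sA s1 sAB[unfolded eAB]])
    show "ct ?fA l = ct f l + of_bool (j = l) - of_bool (f u' = l)" for l
      using u Cons.prems(3,4) by (simp add: ct_upd)
    show "ct ?f1 l = ct f l + of_bool (i = l) - of_bool (f c = l)" for l
      using c by (simp add: ct_upd)
    show "ct (?fA(c := i)) l = ct ?fA l + of_bool (i = l) - of_bool (f c = l)" for l
      unfolding ct_upd[OF c(1), of ?fA] using cu by simp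
  qed
  have IH: "step ?f1 (?fA(c := i)) j (f u') + B_walk_value (?fA(c := i)) os
    = B_walk_value ?f1 os + step (B_walk_end ?f1 os) ((B_walk_end ?f1 os)(u := j, u' := 3)) j (f u')"
    using Cons.IH[OF s1 c(5) Cons.prems(3-5)] Cons.prems(6,7) f1u o1 eAB by simp
  show ?case using sq IH cu unfolding o1 by simp
qed simp

lemma A_walk_B_walk:
  assumes "near_perfect f u v" "B_walk f v os" "A_walk f y (u # as)" "set as \<inter> fst ` set os = {}" "u \<notin> fst ` set os"
  shows "A_walk_value f y (u # as) + B_walk_value (A_walk_end f y (u # as)) os = B_walk_value f os + A_walk_value (B_walk_end f os) y (u # as)"
  using assms
proof (induction as arbitrary: f u)
  case (Cons u' as)
  let ?fA = "f(u := y u, u' := 3)"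
  have a: "u' \<in> A" "u' \<noteq> u" "y u < 3" "p (f u') u' = p (y u) u" "A_walk ?fA y (u' # as)"
    using Cons.prems(3) by auto
  have d: "u' \<notin> fst ` set os" "u \<notin> fst ` set os" using Cons.prems(4,5) by auto
  have sA: "near_perfect ?fA u' v" using near_perfect_A_slide[OF Cons.prems(1) a(1-4)] .
  have "B_walk ?fA v os" using Cons.prems(2) d by (simp add: B_walk_upd)
  then have "A_walk_value ?fA y (u' # as) + B_walk_value (A_walk_end ?fA y (u' # as)) os
      = B_walk_value ?fA os + A_walk_value (B_walk_end ?fA os) y (u' # as)"
    using Cons.IH[OF sA _ a(5)] Cons.prems(4) d by auto
  moreover have "B_walk_end ?fA os = (B_walk_end f os)(u := y u, u' := 3)" using d by (simp add: B_walk_end_upd)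
  moreover have "B_walk_end f os u' = f u'" using d by (simp add: B_walk_end_other)
  ultimately show ?case
    using A_slide_B_walk[OF Cons.prems(1,2) a(1-4) d(1)] by simp
qed simp

text \<open>A regrouping of half-exchanges: \<open>winding\<close> collects the two halves that meet
  in one near-perfect matching, \<open>A_walk_value\<close> the two halves of one exchange. The
  unpaired halves at both ends are the boundary terms.\<close>

lemma winding_A_walk:
  assumes "distinct (as @ [h])"
  shows "winding x y as - right_of ((switch x y (set as))(h := 3)) * lvl (x h)
    = - right_of (x(hd (as @ [h]) := 3)) * lvl (x (hd (as @ [h]))) + A_walk_value (x(hd (as @ [h]) := 3)) y (as @ [h])"
  using assms
proof (induction as arbitrary: x)
  case (Cons a as)
  let ?x = "x(a := y a)"
  obtain a' bs where e: "as @ [h] = a' # bs" by (cases "as @ [h]") auto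
  have aa': "a' \<noteq> a" "a \<noteq> h" using Cons.prems e by (metis distinct.simps(2) append_Cons list.set_intros(1)) (use Cons.prems in auto)
  have switch: "switch x y (set (a # as)) = switch ?x y (set as)" by (auto simp: switch_def fun_upd_apply)
  have "winding ?x y as - right_of ((switch ?x y (set as))(h := 3)) * lvl (?x h)
    = - right_of (?x(a' := 3)) * lvl (?x a') + A_walk_value (?x(a' := 3)) y (a' # bs)"
    using Cons.IH[of ?x] Cons.prems e by simp
  then show ?case
    unfolding switch using aa' e by (simp add: step_def algebra_simps)
qed simp

lemma B_walk_path:
  assumes "distinct (as @ [h])" "set as \<subseteq> A" "\<forall>a\<in>set as. x a < 3 \<and> y a < 3"
    "successively (arc x y) (as @ [h])"
  shows "B_walk (x(h := 3)) (p (x h) h) (map (\<lambda>a. (a, y a)) (rev as))"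
  using assms
proof (induction as arbitrary: x h rule: rev_induct)
  case (snoc a as)
  let ?os = "map (\<lambda>a. (a, y a)) (rev as)"
  have "B_walk (x(a := 3)) (p (x a) a) ?os"
    using snoc.IH[of a x] snoc.prems by (auto simp: successively_append_iff)
  moreover have "a \<notin> fst ` set ?os" "h \<notin> fst ` set ?os" using snoc.prems(1) by auto
  ultimately have "B_walk (x(h := 3, a := y a)) (p (x a) a) ?os"
    by (simp add: B_walk_upd)
  moreover have "p (y a) a = p (x h) h"
    using snoc.prems(4) by (auto simp: successively_append_iff arc_def)
  ultimately show ?case using snoc.prems(1-3) by auto
qed simp

text \<open>
  Both walks start at \<open>x\<close>: one pushes the gap in \<open>A\<close> forwards along the path, the other the gap in \<open>B\<close> backwards. They
  end in the same matching and span a triangular grid of near-perfect matchings.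
\<close>

lemma path_A_walk_B_walk:
  assumes "perfect x" "distinct (as @ [h])" "set (as @ [h]) \<subseteq> A" "\<forall>a\<in>set as. y a < 3"
    "successively (arc x y) (as @ [h])"
  shows "winding x y as - right_of ((switch x y (set as))(h := 3)) * lvl (x h)
    = - right_of (x(h := 3)) * lvl (x h) + B_walk_value (x(h := 3)) (map (\<lambda>a. (a, y a)) (rev as))"
  using assms
proof (induction as arbitrary: h rule: rev_induct)
  case (snoc a as)
  let ?os = "map (\<lambda>a. (a, y a)) (rev as)"
  let ?f1 = "x(a := 3)" and ?f2 = "x(h := 3)"
  let ?f3 = "x(h := 3, a := y a)" and ?e = "(switch x y (set as))(a := 3)"
  have d: "a \<noteq> h" "a \<notin> set as" "h \<notin> set as" "a \<in> A" "h \<in> A" using snoc.prems(2,3) by auto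
  have xA: "\<forall>a\<in>A. x a < 3" using snoc.prems(1) unfolding perfect_def by auto
  have arcs: "successively (arc x y) (as @ [a])" "p (x h) h = p (y a) a"
    using snoc.prems(5) by (auto simp: successively_append_iff arc_def)
  have IH: "winding x y as - right_of ?e * lvl (x a) = - right_of ?f1 * lvl (x a) + B_walk_value ?f1 ?os"
    using snoc.IH[of a] snoc.prems arcs by auto
  have s1: "near_perfect ?f1 a (p (x a) a)" and s2: "near_perfect ?f2 h (p (x h) h)"
    using near_perfect_remove snoc.prems(1) d by auto
  have B_walk: "B_walk ?f1 (p (x a) a) ?os"
    by (rule B_walk_path) (use snoc.prems xA arcs in auto)
  have f3: "?f1(a := y a, h := 3) = ?f3" using d by (auto simp: fun_upd_twist)
  have be: "B_walk_end ?f1 ?os = ?e"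
    unfolding B_walk_end_map using d by (auto simp: switch_def fun_upd_apply)
  have ab: "step ?f1 ?f3 (y a) (x h) + B_walk_value ?f3 ?os
    = B_walk_value ?f1 ?os + step ?e (?e(a := y a, h := 3)) (y a) (x h)"
    using A_slide_B_walk[OF s1 B_walk, of h "y a"] d arcs snoc.prems(4) be f3 by (simp add: image_image)
  have s3: "near_perfect ?f3 h (p (x a) a)"
    using near_perfect_A_slide[OF s1, of h "y a"] d arcs snoc.prems(4) f3 by auto
  \<comment> \<open>The corner of the grid: \<open>x\<close> without its edges at \<open>a\<close>
    and \<open>h\<close>, plus an edge of color \<open>x h\<close>, \<open>x a\<close> or
    \<open>y a\<close>, gives the three corners of a triangle.\<close>
  have tr: "right_of ?f1 * (lvl (y a) - lvl (x a)) + right_of ?f2 * (lvl (x h) - lvl (y a)) + right_of ?f3 * (lvl (x a) - lvl (x h)) = 0"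
    by (rule triangle_closed[OF s1 s2 s3]) (use d in \<open>simp_all add: ct_upd\<close>)
  have sw1: "?e(a := y a, h := 3) = (switch x y (set (as @ [a])))(h := 3)"
    using d by (auto simp: switch_def fun_upd_apply)
  have winding: "winding x y (as @ [a]) = winding x y as + right_of ?e * (lvl (y a) - lvl (x a))"
    if "distinct (as @ [a])"
    using that
  proof -
    have "winding g y (bs @ [a]) = winding g y bs + right_of ((switch g y (set bs))(a := 3)) * (lvl (y a) - lvl (g a))"
      if "a \<notin> set bs" for g bs
      using that
    proof (induction bs arbitrary: g)
      case (Cons b bs)
      have "switch (g(b := y b)) y (set bs) = switch g y (set (b # bs))" by (auto simp: switch_def fun_upd_apply)
      then show ?case using Cons by simp
    qed simp
    then show ?thesis using d by simp
  qed
  show ?case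
    using IH ab tr winding snoc.prems(2) sw1 d
    by (simp add: step_def algebra_simps)
qed simp

end

section \<open>The cycle lemma and cycles on one side of the threshold\<close>

text \<open>The list is cut where its prefix sum is minimal. A prefix of the rotated list that does
  not wrap around has nonnegative sum; one that wraps around has at least the total sum.\<close>

lemma rotate_min_prefix:
  fixes f :: "'a \<Rightarrow> int"
  shows "\<exists>us vs. as = us @ vs
    \<and> (\<forall>ws zs. vs @ us = ws @ zs \<longrightarrow> min 0 (sum_list (map f as)) \<le> sum_list (map f ws))"
proof -
  let ?g = "\<lambda>n. sum_list (map f (take n as))"
  obtain m where m: "m \<in> {..length as}" "\<And>n. n \<le> length as \<Longrightarrow> ?g m \<le> ?g n"
    using ex_min_if_finite[of "?g ` {..length as}"] by (auto simp: not_less)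
  let ?us = "take m as" and ?vs = "drop m as"
  have pre: "sum_list (map f ?us) \<le> sum_list (map f ws)" if "as = ws @ zs" for ws zs
    using m(2)[of "length ws"] that by simp
  have tot: "sum_list (map f as) = sum_list (map f ?us) + sum_list (map f ?vs)"
    by (metis append_take_drop_id map_append sum_list_append)
  have "min 0 (sum_list (map f as)) \<le> sum_list (map f ws)" if e: "?vs @ ?us = ws @ zs" for ws zs
  proof -
    consider us where "?vs = ws @ us" "us @ ?us = zs" | us where "?vs @ us = ws" "?us = us @ zs"
      using e by (auto simp: append_eq_append_conv2)
    then show ?thesis
    proof cases
      case 1
      have "as = (?us @ ws) @ us" using 1 by (metis append_assoc append_take_drop_id)
      from pre[OF this] show ?thesis by simp
    next
      case 2
      have "as = us @ (zs @ ?vs)" using 2 by (metis append_assoc append_take_drop_id)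
      from pre[OF this] tot show ?thesis unfolding 2(1)[symmetric] by simp
    qed
  qed
  then show ?thesis by (intro exI[of _ ?us] exI[of _ ?vs]) simp
qed

lemma successively_next:
  "successively P (as @ [c]) \<Longrightarrow> a \<in> set as \<Longrightarrow> \<exists>a'\<in>set (as @ [c]). P a a'"
  by (induction as) (auto simp: successively_Cons hd_append split: if_splits)

context three_matchings
begin

lemma card_AB: "card A = card B"
  using bij[of 0] bij_betw_same_card by auto

lemma alt_cycle_switch: "alt_cycle x y as \<Longrightarrow> switch x y (set as) = y"
  unfolding alt_cycle_def switch_def by auto

lemma alt_cycle_rev:
  assumes "alt_cycle x y as"
  shows "alt_cycle y x (rev as)"
proof -
  have su: "successively (arc x y) (as @ [hd as])" "as \<noteq> []" using assms unfolding alt_cycle_def by auto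
  have arc: "arc y x = (\<lambda>a b. arc x y b a)" unfolding arc_def by (intro ext) auto
  have "successively (arc y x) (rev as @ [hd (rev as)])"
  proof (cases as rule: rev_cases)
    case (snoc cs z)
    show ?thesis
    proof (cases cs)
      case (Cons a ds)
      then have "as = a # ds @ [z]" using snoc by simp
      then show ?thesis using su unfolding arc by (auto simp: successively_append_iff successively_rev successively_Cons hd_append last_rev hd_rev split: if_splits)
    qed (use su snoc in \<open>simp add: arc\<close>)
  qed (use su in simp)
  then show ?thesis using assms unfolding alt_cycle_def by auto
qed

lemma alt_cycle_rotate1:
  assumes "alt_cycle x y (a # as)"
  shows "alt_cycle x y (as @ [a])"
proof -
  have su: "successively (arc x y) (a # as @ [a])" using assms unfolding alt_cycle_def by auto
  have "successively (arc x y) ((as @ [a]) @ [hd (as @ [a])])"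
    unfolding successively_append_iff[of _ "as @ [a]" "[hd (as @ [a])]"]
    using su by (auto simp: successively_Cons)
  then show ?thesis using assms unfolding alt_cycle_def by auto
qed

lemma alt_cycle_rotate: "alt_cycle x y (us @ vs) \<Longrightarrow> alt_cycle x y (vs @ us)"
proof (induction us arbitrary: vs)
  case (Cons a us)
  then show ?case using alt_cycle_rotate1[of x y a "us @ vs"] Cons.IH[of "vs @ [a]"] by simp
qed simp

lemma alt_cycle_image:
  assumes "alt_cycle x y as"
  shows "(\<lambda>a. p (y a) a) ` set as \<subseteq> (\<lambda>a. p (x a) a) ` set as"
proof
  fix b assume "b \<in> (\<lambda>a. p (y a) a) ` set as"
  then obtain a where a: "a \<in> set as" "b = p (y a) a" by auto
  have "as \<noteq> []" "successively (arc x y) (as @ [hd as])" using assms unfolding alt_cycle_def by auto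
  then obtain a' where "a' \<in> set as" "arc x y a a'"
    using successively_next[of "arc x y" as "hd as" a] a by (metis hd_in_set insertE list.set(2) set_rotate1 rotate1.simps(2))
  then show "b \<in> (\<lambda>a. p (x a) a) ` set as" using a unfolding arc_def by auto
qed

text \<open>Along the cycle \<open>x\<close> and \<open>y\<close> cover the same vertices of
  \<open>B\<close>, so \<open>y\<close> still covers all of \<open>B\<close>; by counting, its
  partner map is then injective.\<close>

lemma alt_cycle_perfect:
  assumes "perfect x" "alt_cycle x y as"
  shows "perfect y"
proof -
  let ?f = "\<lambda>x a. p (x a) a"
  have y3: "\<forall>a\<in>A. y a < 3" using assms unfolding perfect_def alt_cycle_def by metis
  have "?f x ` A \<subseteq> ?f y ` A"
  proof
    fix b assume "b \<in> ?f x ` A"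
    then obtain a where a: "a \<in> A" "b = ?f x a" by auto
    show "b \<in> ?f y ` A"
    proof (cases "a \<in> set as")
      case True
      then have "b \<in> ?f y ` set as" using alt_cycle_image[OF alt_cycle_rev[OF assms(2)]] a by auto
      then show ?thesis using assms(2) unfolding alt_cycle_def by auto
    next
      case False
      then have "y a = x a" using assms(2) unfolding alt_cycle_def by auto
      then show ?thesis using a by (intro image_eqI[of _ _ a]) auto
    qed
  qed
  moreover have "?f x ` A = B" using assms(1) unfolding perfect_def bij_betw_def by auto
  moreover have "?f y ` A \<subseteq> B" using y3 p_mem by auto
  ultimately have im: "?f y ` A = B" by auto
  then have "inj_on (?f y) A" using eq_card_imp_inj_on[OF fin, of "?f y"] card_AB by simp
  then show ?thesis using im y3 unfolding perfect_def bij_betw_def by auto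
qed

lemma ct_switch:
  assumes "distinct as" "set as \<subseteq> A"
  shows "ct (switch x y (set as)) i = ct x i + sum_list (map (\<lambda>a. of_bool (y a = i) - of_bool (x a = i)) as)"
  using assms
proof (induction as)
  case (Cons a as)
  have "switch x y (set (a # as)) = (switch x y (set as))(a := y a)" by (simp add: switch_upd)
  moreover have "switch x y (set as) a = x a" "a \<in> A" using Cons.prems by (auto simp: switch_def)
  ultimately show ?case using Cons by (simp add: ct_upd)
qed simp

end

context unhit
begin

lemma winding_append: "winding x y (as @ bs) = winding x y as + winding (switch x y (set as)) y bs"
proof (induction as arbitrary: x)
  case (Cons a as)
  have "switch (x(a := y a)) y (set as) = switch x y (set (a # as))" by (auto simp: switch_def fun_upd_apply)
  then show ?case using Cons by simp
qed simp

lemma winding_cong: "(\<And>a. a \<in> set as \<Longrightarrow> y a = y' a) \<Longrightarrow> winding x y as = winding x y' as"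
  by (induction as arbitrary: x) auto

lemma winding_rev:
  assumes "distinct as"
  shows "winding (switch x y (set as)) x (rev as) = - winding x y as"
  using assms
proof (induction as arbitrary: x)
  case (Cons a as)
  let ?x = "x(a := y a)"
  have s: "switch x y (set (a # as)) = switch ?x y (set as)" by (auto simp: switch_def fun_upd_apply)
  have "winding (switch ?x y (set as)) x (rev as) = winding (switch ?x y (set as)) ?x (rev as)"
    by (rule winding_cong) (use Cons.prems in \<open>auto simp: fun_upd_apply\<close>)
  moreover have "switch (switch ?x y (set as)) x (set (rev as)) = ?x"
    using Cons.prems by (auto simp: switch_def fun_upd_apply)
  ultimately show ?case unfolding s using Cons by (simp add: winding_append)
qed simp

lemma B_walk_value_rev:
  assumes "distinct bs"
  shows "B_walk_value (B_walk_end f (map (\<lambda>a. (a, y a)) bs)) (map (\<lambda>a. (a, f a)) (rev bs))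
    = - B_walk_value f (map (\<lambda>a. (a, y a)) bs)"
  using assms
proof (induction bs arbitrary: f)
  case (Cons b bs)
  let ?f = "f(b := y b)" and ?os = "map (\<lambda>a. (a, y a)) bs"
  have e: "map (\<lambda>a. (a, f a)) (rev bs) = map (\<lambda>a. (a, ?f a)) (rev bs)"
    using Cons.prems by (auto simp: fun_upd_apply)
  have "B_walk_value (B_walk_end f (map (\<lambda>a. (a, y a)) (b # bs))) (map (\<lambda>a. (a, f a)) (rev (b # bs)))
    = B_walk_value (B_walk_end ?f ?os) (map (\<lambda>a. (a, ?f a)) (rev bs) @ [(b, f b)])"
    by (simp only: list.map rev.simps map_append B_walk_end.simps e)
  moreover have "B_walk_end (B_walk_end ?f ?os) (map (\<lambda>a. (a, ?f a)) (rev bs)) = ?f"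
    unfolding B_walk_end_map by (auto simp: fun_upd_apply)
  ultimately show ?case using Cons step_rev[of ?f f "f b" "y b"]
    by (simp add: B_walk_value_append)
qed simp

lemma winding_B_walk:
  assumes "perfect x" "alt_cycle x y (as @ [h])"
  shows "winding x y (as @ [h]) = - right_of (x(h := 3)) * lvl (x h)
    + B_walk_value (x(h := 3)) (map (\<lambda>a. (a, y a)) (rev as)) + right_of (y(h := 3)) * lvl (y h)"
proof -
  have c: "distinct (as @ [h])" "set (as @ [h]) \<subseteq> A" "\<forall>a\<in>set as. y a < 3"
    "successively (arc x y) (as @ [h])"
    using assms(2) unfolding alt_cycle_def by (auto simp: successively_append_iff)
  have "y = switch x y (set (as @ [h]))" using alt_cycle_switch[OF assms(2)] by simp
  also have "\<dots> = (switch x y (set as))(h := y h)" by (simp add: switch_upd)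
  finally have y: "(switch x y (set as))(h := 3) = y(h := 3)" by (metis fun_upd_upd)
  show ?thesis using path_A_walk_B_walk[OF assms(1) c] c(1) y
    by (simp add: winding_append switch_apply algebra_simps)
qed

text \<open>
  The B-walk with its gap at \<open>a\<close> is homotopic to the A-walk ending at \<open>a\<close>, and, read from \<open>y\<close>, to the A-walk starting at \<open>a\<close>.
\<close>

lemma winding_rotate1:
  assumes "perfect x" "alt_cycle x y (a # as)"
  shows "winding x y (a # as) = winding x y (as @ [a])"
proof -
  have c1: "alt_cycle x y (as @ [a])" using alt_cycle_rotate1[OF assms(2)] .
  have c2: "alt_cycle y x (rev as @ [a])" using alt_cycle_rev[OF assms(2)] by simp
  have py: "perfect y" using alt_cycle_perfect[OF assms] .
  have d: "distinct as" "a \<notin> set as" using c1 unfolding alt_cycle_def by auto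
  have "winding (switch x y (set (a # as))) x (rev (a # as)) = - winding x y (a # as)"
    by (rule winding_rev) (use d in simp)
  then have 1: "winding y x (rev as @ [a]) = - winding x y (a # as)"
    using alt_cycle_switch[OF assms(2)] by simp
  let ?f = "x(a := 3)"
  have e: "map (\<lambda>b. (b, ?f b)) as = map (\<lambda>b. (b, x b)) as" using d by (auto simp: fun_upd_apply)
  have be: "B_walk_end ?f (map (\<lambda>a. (a, y a)) (rev as)) = y(a := 3)"
    unfolding B_walk_end_map using assms(2) unfolding alt_cycle_def by (auto simp: fun_eq_iff fun_upd_apply)
  have 2: "B_walk_value (y(a := 3)) (map (\<lambda>b. (b, x b)) as) = - B_walk_value ?f (map (\<lambda>a. (a, y a)) (rev as))"
    using B_walk_value_rev[of "rev as" ?f y, unfolded rev_rev_ident distinct_rev be e] d(1) .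
  show ?thesis
    using winding_B_walk[OF assms(1) c1] winding_B_walk[OF py c2] 1 2 by simp
qed

lemma winding_rotate:
  assumes "perfect x" "alt_cycle x y (us @ vs)"
  shows "winding x y (us @ vs) = winding x y (vs @ us)"
  using assms(2)
proof (induction us arbitrary: vs)
  case (Cons a us)
  then show ?case
    using winding_rotate1[OF assms(1), of y a "us @ vs"] alt_cycle_rotate1[of x y a "us @ vs"] Cons.IH[of "vs @ [a]"] by simp
qed simp

text \<open>A term can only count if uncovering \<open>a\<close> leaves exactly \<open>t\<close>
  edges of color \<open>0\<close>. As the matchings before and after the recoloring have more,
  \<open>a\<close> then has color \<open>0\<close> in both, and the two levels in the term
  cancel.\<close>

lemma winding_prefixes_above:
  assumes "set as \<subseteq> A" "\<And>ws zs. as = ws @ zs \<Longrightarrow> t < ct (switch x y (set ws)) 0"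
  shows "winding x y as = 0"
  using assms
proof (induction as arbitrary: x)
  case (Cons a as)
  have "winding (x(a := y a)) y as = 0"
  proof (rule Cons.IH)
    fix ws zs assume "as = ws @ zs"
    moreover have "switch (x(a := y a)) y (set ws) = switch x y (set (a # ws))"
      by (auto simp: switch_def fun_upd_apply)
    ultimately show "t < ct (switch (x(a := y a)) y (set ws)) 0"
      using Cons.prems(2)[of "a # ws" zs] by simp
  qed (use Cons.prems in simp)
  moreover have "t < ct x 0" "t < ct (x(a := y a)) 0"
    using Cons.prems(2)[of "[]"] Cons.prems(2)[of "[a]"] by (auto simp: switch_upd[symmetric])
  ultimately show ?case using Cons.prems(1) by (auto simp: right_of_def ct_upd of_bool_def split: if_splits)
qed simp

lemma winding_prefixes_below:
  assumes "set as \<subseteq> A" "\<And>ws zs. as = ws @ zs \<Longrightarrow> ct (switch x y (set ws)) 0 \<le> t"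
  shows "winding x y as = 0"
  using assms
proof (induction as arbitrary: x)
  case (Cons a as)
  have "winding (x(a := y a)) y as = 0"
  proof (rule Cons.IH)
    fix ws zs assume "as = ws @ zs"
    moreover have "switch (x(a := y a)) y (set ws) = switch x y (set (a # ws))"
      by (auto simp: switch_def fun_upd_apply)
    ultimately show "ct (switch (x(a := y a)) y (set ws)) 0 \<le> t"
      using Cons.prems(2)[of "a # ws" zs] by simp
  qed (use Cons.prems in simp)
  moreover have "ct x 0 \<le> t" "ct (x(a := y a)) 0 \<le> t"
    using Cons.prems(2)[of "[]"] Cons.prems(2)[of "[a]"] by (auto simp: switch_upd[symmetric])
  ultimately show ?case using Cons.prems(1) by (auto simp: right_of_def ct_upd of_bool_def split: if_splits)
qed simp

text \<open>
  Started after a minimal prefix sum of color \<open>0\<close>, the walk never comes down to level \<open>t\<close>.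
\<close>

lemma winding_above:
  assumes "perfect x" "alt_cycle x y as" "t < ct x 0" "t < ct y 0"
  shows "winding x y as = 0"
proof -
  let ?f = "\<lambda>a. lvl (y a) - lvl (x a)"
  obtain us vs where uv: "as = us @ vs"
    "\<And>ws zs. vs @ us = ws @ zs \<Longrightarrow> min 0 (sum_list (map ?f as)) \<le> sum_list (map ?f ws)"
    using rotate_min_prefix[of as ?f] by blast
  have c: "distinct as" "set as \<subseteq> A" using assms(2) unfolding alt_cycle_def by auto
  have tot: "ct y 0 = ct x 0 + sum_list (map ?f as)"
    using ct_switch[OF c, of x y 0] alt_cycle_switch[OF assms(2)] by simp
  have "winding x y (vs @ us) = 0"
  proof (rule winding_prefixes_above)
    fix ws zs assume e: "vs @ us = ws @ zs"
    have "set (vs @ us) = set as" "distinct (vs @ us)" using uv(1) c(1) by auto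
    then have "distinct ws" "set ws \<subseteq> A" using e c(2) by (metis distinct_append) (use e \<open>set (vs @ us) = set as\<close> c(2) in auto)
    then show "t < ct (switch x y (set ws)) 0"
      using ct_switch[of ws x y 0] uv(2)[OF e] assms(3,4) tot by linarith
  qed (use c uv(1) in auto)
  then show ?thesis using winding_rotate[OF assms(1), of y us vs] assms(2) uv(1) by simp
qed

lemma winding_below:
  assumes "perfect x" "alt_cycle x y as" "ct x 0 \<le> t" "ct y 0 \<le> t"
  shows "winding x y as = 0"
proof -
  \<comment> \<open>The negated weights \<open>?g\<close> make the rotation start at a maximal
    prefix sum of color \<open>0\<close>, so that no prefix exceeds both ends.\<close>
  let ?f = "\<lambda>a. lvl (y a) - lvl (x a)" and ?g = "\<lambda>a. lvl (x a) - lvl (y a)"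
  obtain us vs where uv: "as = us @ vs"
    "\<And>ws zs. vs @ us = ws @ zs \<Longrightarrow> min 0 (sum_list (map ?g as)) \<le> sum_list (map ?g ws)"
    using rotate_min_prefix[of as ?g] by blast
  have neg: "sum_list (map ?g ws) = - sum_list (map ?f ws)" for ws by (induction ws) auto
  have c: "distinct as" "set as \<subseteq> A" using assms(2) unfolding alt_cycle_def by auto
  have tot: "ct y 0 = ct x 0 + sum_list (map ?f as)"
    using ct_switch[OF c, of x y 0] alt_cycle_switch[OF assms(2)] by simp
  have "winding x y (vs @ us) = 0"
  proof (rule winding_prefixes_below)
    fix ws zs assume e: "vs @ us = ws @ zs"
    have "set (vs @ us) = set as" "distinct (vs @ us)" using uv(1) c(1) by auto
    then have "distinct ws" "set ws \<subseteq> A" using e c(2) by (metis distinct_append) (use e \<open>set (vs @ us) = set as\<close> c(2) in auto)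
    then show "ct (switch x y (set ws)) 0 \<le> t"
      using ct_switch[of ws x y 0] uv(2)[OF e] assms(3,4) tot unfolding neg by linarith
  qed (use c uv(1) in auto)
  then show ?thesis using winding_rotate[OF assms(1), of y us vs] assms(2) uv(1) by simp
qed

end

section \<open>Theta graphs and dumbbells\<close>

lemma successively_tl_mono:
  "successively P (a # as) \<Longrightarrow> (\<And>b c. b \<in> set (a # as) \<Longrightarrow> c \<in> set as \<Longrightarrow> P b c \<Longrightarrow> Q b c)
    \<Longrightarrow> successively Q (a # as)"
  by (induction as arbitrary: a) auto

lemma successively_appendD1: "successively P (as @ bs) \<Longrightarrow> successively P as"
  by (simp add: successively_append_iff)

lemma successively_glue:
  "successively P (as @ [c]) \<Longrightarrow> successively P (c # bs) \<Longrightarrow> successively P ((as @ [c]) @ bs)"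
  unfolding successively_append_iff[of P "as @ [c]" bs] by (auto simp: successively_Cons)

context three_matchings
begin

text \<open>
  The branch vertices are \<open>r\<close> and the \<open>x\<close>-partner of the first vertex of \<open>Q @ [r]\<close>; the paths between them run through
  \<open>Q\<close>, \<open>Cs\<close> and \<open>Es\<close>.
\<close>

definition theta :: "('a \<Rightarrow> nat) \<Rightarrow> ('a \<Rightarrow> nat) \<Rightarrow> ('a \<Rightarrow> nat) \<Rightarrow> 'a list \<Rightarrow> 'a \<Rightarrow> 'a list \<Rightarrow> 'a list \<Rightarrow> bool" where
  "theta x y z Q r Cs Es \<longleftrightarrow> alt_cycle x y (Q @ r # Cs) \<and> alt_cycle x z (Q @ r # Es)
     \<and> (\<forall>a\<in>set Q. y a = z a) \<and> set Cs \<inter> set Es = {}"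

text \<open>On \<open>Cs\<close> the matching \<open>z\<close> agrees with \<open>x\<close>, and on
  \<open>Es\<close> the matching \<open>y\<close> does. So the path through \<open>Cs\<close> is
  read backwards, the one through \<open>Es\<close> forwards, and they are closed up at the second
  branch vertex.\<close>

lemma theta_third_cycle:
  assumes "theta x y z Q r Cs Es"
  shows "alt_cycle y z (rev Cs @ r # Es)"
proof -
  have c: "alt_cycle x y (Q @ r # Cs)" "alt_cycle x z (Q @ r # Es)" "\<forall>a\<in>set Q. y a = z a" "set Cs \<inter> set Es = {}"
    using assms unfolding theta_def by auto
  have yx: "\<forall>a. a \<notin> set (Q @ r # Cs) \<longrightarrow> y a = x a" and zx: "\<forall>a. a \<notin> set (Q @ r # Es) \<longrightarrow> z a = x a"
    and d: "distinct (Q @ r # Cs)" "distinct (Q @ r # Es)"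
    using c unfolding alt_cycle_def by auto
  let ?q = "hd (Q @ [r])"
  have sC: "successively (arc x y) (r # Cs @ [?q])" and sE: "successively (arc x z) (r # Es @ [?q])"
    using c(1,2) unfolding alt_cycle_def by (auto simp: successively_append_iff hd_append)
  have "successively (\<lambda>a b. arc y z b a) (r # Cs)"
  proof (rule successively_tl_mono[of "arc x y"])
    show "successively (arc x y) (r # Cs)" using sC successively_appendD1[of _ "r # Cs"] by simp
    fix b e assume "e \<in> set Cs" "arc x y b e"
    then show "arc y z e b" using zx d c(4) unfolding arc_def by auto
  qed
  then have 1: "successively (arc y z) (rev Cs @ [r])"
    using successively_rev[of "arc y z" "r # Cs"] by simp
  have 2: "successively (arc y z) (r # Es)"
  proof (rule successively_tl_mono[of "arc x z"])
    show "successively (arc x z) (r # Es)" using sE successively_appendD1[of _ "r # Es"] by simp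
    fix b e assume "e \<in> set Es" "arc x z b e"
    then show "arc y z b e" using yx d c(4) unfolding arc_def by auto
  qed
  have "arc x z (last (r # Es)) ?q" "arc x y (last (r # Cs)) ?q"
    using sE sC successively_append_iff[of "arc x z" "r # Es" "[?q]"]
      successively_append_iff[of "arc x y" "r # Cs" "[?q]"] by auto
  then have 3: "arc y z (last (r # Es)) (last (r # Cs))" unfolding arc_def by auto
  have hd: "hd (rev Cs @ r # Es) = last (r # Cs)" by (cases Cs rule: rev_cases) auto
  have "successively (arc y z) ((rev Cs @ [r]) @ Es @ [last (r # Cs)])"
    using successively_glue[OF 1, of "Es @ [last (r # Cs)]"]
      successively_append_iff[of "arc y z" "r # Es" "[last (r # Cs)]"] 2 3 by simp
  moreover have "\<forall>a\<in>set (rev Cs @ r # Es). y a < 3 \<and> z a < 3"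
  proof
    fix a assume "a \<in> set (rev Cs @ r # Es)"
    then consider "a = r" | "a \<in> set Cs" | "a \<in> set Es" by auto
    then show "y a < 3 \<and> z a < 3"
      by cases (use c d yx zx in \<open>auto simp: alt_cycle_def\<close>)
  qed
  moreover have "\<forall>a. a \<notin> set (rev Cs @ r # Es) \<longrightarrow> z a = y a"
  proof (intro allI impI)
    fix a assume a: "a \<notin> set (rev Cs @ r # Es)"
    show "z a = y a"
      by (cases "a \<in> set Q") (use a yx zx c(3) in auto)
  qed
  moreover have "distinct (rev Cs @ r # Es)" using d c(4) by auto
  moreover have "set (rev Cs @ r # Es) \<subseteq> A" using c(1,2) unfolding alt_cycle_def by auto
  ultimately show ?thesis unfolding alt_cycle_def hd by simp
qed

lemma alt_cycle_disjoint:
  assumes "alt_cycle x y js" "alt_cycle x x' cs" "set js \<inter> set cs = {}"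
  shows "alt_cycle x' (switch x' y (set js)) js"
proof -
  have off: "\<forall>a. a \<notin> set cs \<longrightarrow> x' a = x a" using assms(2) unfolding alt_cycle_def by auto
  have j: "js \<noteq> []" "successively (arc x y) (js @ [hd js])" using assms(1) unfolding alt_cycle_def by auto
  have hd: "hd js \<notin> set cs" "hd js \<in> set js" using hd_in_set[OF j(1)] assms(3) by blast+
  have "successively (arc x' (switch x' y (set js))) (js @ [hd js])"
    by (rule successively_mono[OF j(2)]) (use hd assms(3) off in \<open>auto simp: arc_def switch_def\<close>)
  then show ?thesis using assms off unfolding alt_cycle_def by (auto simp: switch_def)
qed

lemma B_walk_cong: "(\<And>b. b \<in> fst ` set os \<Longrightarrow> f b = g b) \<Longrightarrow> B_walk f v os = B_walk g v os"
proof (induction os arbitrary: f g v)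
  case (Cons o1 os)
  obtain a j where o1: "o1 = (a, j)" by fastforce
  have "f a = g a" using Cons.prems o1 by auto
  moreover have "B_walk (f(a := j)) (p (g a) a) os = B_walk (g(a := j)) (p (g a) a) os"
    by (rule Cons.IH) (use Cons.prems in \<open>auto simp: fun_upd_apply\<close>)
  ultimately show ?case using o1 by simp
qed simp

text \<open>The return leg of a lasso: while the path is recolored from \<open>q\<close> back to
  \<open>z\<close>, the gap in \<open>B\<close> moves forwards, because the \<open>q\<close>-edge of
  each vertex ends at the partner of the next one.\<close>

lemma B_walk_restore:
  assumes "distinct ps" "set ps \<subseteq> A" "\<forall>b\<in>set ps. f b = q b \<and> q b < 3 \<and> z b < 3"
    "successively (arc z q) (b0 # ps)"
  shows "B_walk f (p (q b0) b0) (map (\<lambda>b. (b, z b)) ps)"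
  using assms
proof (induction ps arbitrary: f b0)
  case (Cons b ps)
  have "B_walk (f(b := z b)) (p (q b) b) (map (\<lambda>b. (b, z b)) ps)"
    by (rule Cons.IH) (use Cons.prems in \<open>auto simp: fun_upd_apply\<close>)
  then show ?case using Cons.prems by (auto simp: arc_def)
qed simp

end

context unhit
begin

text \<open>Going back along \<open>Cs\<close> from \<open>y\<close> cancels the \<open>Cs\<close>
  part of the first cycle and leaves only \<open>Q\<close> and \<open>r\<close> recolored. There the
  two recolorings of \<open>r\<close> compose to the one from \<open>x r\<close> to
  \<open>z r\<close>, and both sides continue through \<open>Es\<close>.\<close>

lemma winding_theta:
  assumes "theta x y z Q r Cs Es"
  shows "winding x y (Q @ r # Cs) + winding y z (rev Cs @ r # Es) = winding x z (Q @ r # Es)"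
proof -
  have c: "alt_cycle x y (Q @ r # Cs)" "alt_cycle x z (Q @ r # Es)" "\<forall>a\<in>set Q. y a = z a" "set Cs \<inter> set Es = {}"
    using assms unfolding theta_def by auto
  have yx: "\<forall>a. a \<notin> set (Q @ r # Cs) \<longrightarrow> y a = x a" and zx: "\<forall>a. a \<notin> set (Q @ r # Es) \<longrightarrow> z a = x a"
    and d: "distinct (Q @ r # Cs)" "distinct (Q @ r # Es)"
    using c unfolding alt_cycle_def by auto
  let ?g = "switch x y (set Q)"
  let ?g1 = "?g(r := y r)"
  have g: "switch x z (set Q) = ?g" using c(3) by (auto simp: switch_def)
  have Q: "winding x z Q = winding x y Q" by (rule winding_cong) (use c(3) in auto)
  have r: "?g r = x r" using d by (auto simp: switch_def)
  have y: "switch ?g1 y (set Cs) = y" using yx d by (auto simp: switch_def fun_upd_apply fun_eq_iff)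
  have "winding y z (rev Cs) = winding (switch ?g1 y (set Cs)) ?g1 (rev Cs)"
    unfolding y by (rule winding_cong) (use zx d c(4) in \<open>auto simp: switch_def fun_upd_apply\<close>)
  also have "\<dots> = - winding ?g1 y Cs" by (rule winding_rev) (use d in auto)
  finally have Cs: "winding y z (rev Cs) = - winding ?g1 y Cs" .
  have h: "switch y z (set Cs) = ?g1"
    using yx zx d c(4) by (auto simp: switch_def fun_upd_apply fun_eq_iff)
  show ?thesis
    by (simp add: winding_append g Q r Cs h algebra_simps)
qed

lemma winding_A_walk_cycle:
  assumes "alt_cycle x y (h # js)"
  shows "winding x y (h # js) = - right_of (x(h := 3)) * lvl (x h) + A_walk_value (x(h := 3)) y (h # js)
    + right_of (y(last (h # js) := 3)) * lvl (y (last (h # js)))"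
proof -
  obtain ks e where ks: "h # js = ks @ [e]" by (metis list.discI rev_exhaust)
  have d: "distinct (ks @ [e])" using assms ks unfolding alt_cycle_def by metis
  have "y = switch x y (set (ks @ [e]))" using alt_cycle_switch[OF assms] ks by simp
  also have "\<dots> = (switch x y (set ks))(e := y e)" by (simp add: switch_upd)
  finally have y: "(switch x y (set ks))(e := 3) = y(e := 3)" by (metis fun_upd_upd)
  have hd: "hd (ks @ [e]) = h" using ks by (metis list.sel(1))
  show ?thesis
    using winding_A_walk[OF d, of x y] d y unfolding ks hd
    by (simp add: winding_append switch_apply algebra_simps)
qed

lemma A_walk_value_cong: "(\<And>b. b \<in> set bs \<Longrightarrow> y b = y' b) \<Longrightarrow> A_walk_value f y bs = A_walk_value f y' bs"
  by (induction f y bs rule: A_walk_value.induct) auto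

text \<open>
  The gap in \<open>B\<close> goes back along a path to the cycle, once around the cycle, and returns along the path.
\<close>

definition lasso_ops :: "('a \<Rightarrow> nat) \<Rightarrow> ('a \<Rightarrow> nat) \<Rightarrow> ('a \<Rightarrow> nat) \<Rightarrow> 'a \<Rightarrow> 'a list \<Rightarrow> 'a list \<Rightarrow> ('a \<times> nat) list" where
  "lasso_ops z z' q a ps cs = map (\<lambda>b. (b, q b)) (rev (a # ps)) @ map (\<lambda>b. (b, z' b)) (rev cs)
     @ map (\<lambda>b. (b, z' b)) (a # ps)"

text \<open>Each path leg of the gap in \<open>B\<close> is traded for the A-walk along the path
  from \<open>a\<close> to \<open>h\<close>. This A-walk commutes with the B-walk around the cycle,
  so its copies before and after the turn cancel and the winding number of the cycle alone
  remains.\<close>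

lemma lasso:
  assumes "perfect z" and alt_cycle: "alt_cycle z z' (a # cs)" and dP: "distinct (a # ps @ [h])"
    and PA: "set (ps @ [h]) \<subseteq> A" and disj: "set (ps @ [h]) \<inter> set (a # cs) = {}"
    and q3: "\<forall>b\<in>set (a # ps). q b < 3" and P: "successively (arc z q) (a # ps @ [h])"
  shows lasso_winding: "- right_of (z(h := 3)) * lvl (z h) + B_walk_value (z(h := 3)) (lasso_ops z z' q a ps cs)
      + right_of (z'(h := 3)) * lvl (z h) = winding z z' (a # cs)"
    and lasso_B_walk: "B_walk (z(h := 3)) (p (z h) h) (lasso_ops z z' q a ps cs)"
    and lasso_end: "B_walk_end (z(h := 3)) (lasso_ops z z' q a ps cs) = z'(h := 3)"
proof -
  let ?os1 = "map (\<lambda>b. (b, q b)) (rev (a # ps))" and ?os2 = "map (\<lambda>b. (b, z' b)) (rev cs)"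
  let ?os3 = "map (\<lambda>b. (b, z' b)) (a # ps)"
  let ?P = "a # ps"
  let ?fh = "(switch z q (set ?P))(h := 3)" and ?f2 = "(switch z' q (set ?P))(h := 3)"
  have pz': "perfect z'" using alt_cycle_perfect[OF assms(1) alt_cycle] .
  have z3: "\<forall>a\<in>A. z a < 3" "\<forall>a\<in>A. z' a < 3" using assms(1) pz' unfolding perfect_def by auto
  have C: "a \<in> A" "set cs \<subseteq> A" "distinct (a # cs)" "\<forall>b. b \<notin> set (a # cs) \<longrightarrow> z' b = z b"
    "successively (arc z z') (a # cs @ [a])" using alt_cycle unfolding alt_cycle_def by auto
  have z'P: "\<forall>b\<in>set (ps @ [h]). z' b = z b" using C(4) disj by blast
  have b1: "B_walk_end (z(h := 3)) ?os1 = ?fh"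
    unfolding B_walk_end_map using dP by (auto simp: switch_def fun_upd_apply fun_eq_iff)
  have b1': "B_walk_end (z'(h := 3)) ?os1 = ?f2"
    unfolding B_walk_end_map using dP by (auto simp: switch_def fun_upd_apply fun_eq_iff)
  have b2: "B_walk_end ?fh ?os2 = ?f2"
    unfolding B_walk_end_map using C(3,4) disj by (auto simp: switch_def fun_upd_apply fun_eq_iff)
  have b3: "B_walk_end ?f2 ?os3 = z'(h := 3)"
    unfolding B_walk_end_map using dP by (auto simp: switch_def fun_upd_apply fun_eq_iff)
  show "B_walk_end (z(h := 3)) (lasso_ops z z' q a ps cs) = z'(h := 3)"
    unfolding lasso_ops_def by (simp only: B_walk_end_append b1 b2 b3)
  have m1: "B_walk_gap (z(h := 3)) (p (z h) h) ?os1 = p (z a) a"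
    using dP by (simp add: B_walk_gap_append B_walk_end_other image_image)
  have bw1: "B_walk (z(h := 3)) (p (z h) h) ?os1"
    by (rule B_walk_path) (use dP PA C P q3 z3 in auto)
  have cy2: "alt_cycle z z' (cs @ [a])" using alt_cycle_rotate1[OF alt_cycle] .
  have bw2': "B_walk (z(a := 3)) (p (z a) a) ?os2"
    by (rule B_walk_path) (use C z3 in \<open>auto simp: successively_Cons\<close>)
  have bw2: "B_walk ?fh (p (z a) a) ?os2"
  proof -
    have "B_walk (z(a := 3)) (p (z a) a) ?os2 = B_walk ?fh (p (z a) a) ?os2"
    proof (rule B_walk_cong)
      fix b assume "b \<in> fst ` set ?os2"
      then have "b \<in> set cs" by auto
      then show "(z(a := 3)) b = ?fh b" using disj C(3) dP by (auto simp: switch_def fun_upd_apply)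
    qed
    then show ?thesis using bw2' by simp
  qed
  have m2: "B_walk_gap ?fh (p (z a) a) ?os2 = p (z' a) a"
  proof (cases cs)
    case Nil
    then show ?thesis using C(5) by (auto simp: arc_def)
  next
    case (Cons c ds)
    have "?fh c = z c" using disj C(3) Cons by (auto simp: switch_def fun_upd_apply)
    moreover have "c \<notin> set ds" using C(3) Cons by auto
    ultimately show ?thesis using C(5) Cons
      by (simp add: B_walk_gap_append B_walk_end_other image_image arc_def)
  qed
  have bw3: "B_walk ?f2 (p (z' a) a) ?os3"
  proof -
    have f2a: "?f2 a = q a" using dP by (auto simp: switch_def fun_upd_apply)
    have "B_walk (?f2(a := z' a)) (p (q a) a) (map (\<lambda>b. (b, z' b)) ps)"
    proof (rule B_walk_restore[where q = q and z = z' and ps = ps])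
      have "successively (arc z q) (a # ps)"
        using P successively_appendD1[of _ "a # ps"] by simp
      then show "successively (arc z' q) (a # ps)"
        by (rule successively_tl_mono) (use z'P in \<open>auto simp: arc_def\<close>)
    qed (use dP PA q3 z3 in \<open>auto simp: switch_def fun_upd_apply\<close>)
    then show ?thesis using C(1) q3 z3 f2a by simp
  qed
  show "B_walk (z(h := 3)) (p (z h) h) (lasso_ops z z' q a ps cs)"
    unfolding lasso_ops_def by (simp only: B_walk_append b1 m1 b2 m2 bw1 bw2 bw3)
  have bv: "B_walk_value (z(h := 3)) (lasso_ops z z' q a ps cs) = B_walk_value (z(h := 3)) ?os1 + B_walk_value ?fh ?os2 + B_walk_value ?f2 ?os3"
    unfolding lasso_ops_def by (simp only: B_walk_value_append b1 b2)
  have P': "successively (arc z' q) (a # ps @ [h])"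
    using P by (rule successively_tl_mono) (use z'P in \<open>auto simp: arc_def\<close>)
  have t1: "winding z q ?P - right_of ?fh * lvl (z h) = - right_of (z(h := 3)) * lvl (z h) + B_walk_value (z(h := 3)) ?os1"
    by (rule path_A_walk_B_walk[OF assms(1)]) (use dP PA C P q3 in auto)
  have t2: "winding z' q ?P - right_of ?f2 * lvl (z' h) = - right_of (z'(h := 3)) * lvl (z' h) + B_walk_value (z'(h := 3)) ?os1"
    by (rule path_A_walk_B_walk[OF pz']) (use dP PA C P' q3 in auto)
  have a1: "winding z q ?P - right_of ?fh * lvl (z h) = - right_of (z(a := 3)) * lvl (z a) + A_walk_value (z(a := 3)) q (a # ps @ [h])"
    using winding_A_walk[of ?P h z q] dP by simp
  have a2: "winding z' q ?P - right_of ?f2 * lvl (z' h) = - right_of (z'(a := 3)) * lvl (z' a) + A_walk_value (z'(a := 3)) q (a # ps @ [h])"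
    using winding_A_walk[of ?P h z' q] dP by simp
  have ae: "A_walk_end (z(a := 3)) q (a # ps @ [h]) = ?fh"
    using A_walk_end_path[of ?P h z q] dP by simp
  have be: "B_walk_end (z(a := 3)) ?os2 = z'(a := 3)"
    unfolding B_walk_end_map using C(3,4) by (auto simp: fun_upd_apply fun_eq_iff)
  have "A_walk_value (z(a := 3)) q (a # ps @ [h]) + B_walk_value (A_walk_end (z(a := 3)) q (a # ps @ [h])) ?os2
    = B_walk_value (z(a := 3)) ?os2 + A_walk_value (B_walk_end (z(a := 3)) ?os2) q (a # ps @ [h])"
  proof (rule A_walk_B_walk[OF near_perfect_remove[OF assms(1) C(1)] bw2'])
    show "A_walk (z(a := 3)) q (a # ps @ [h])"
      by (rule A_walk_path) (use dP PA q3 P in \<open>auto simp: butlast_append\<close>)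
  qed (use disj C(3) in \<open>auto simp: image_image\<close>)
  then have r: "A_walk_value (z(a := 3)) q (a # ps @ [h]) + B_walk_value ?fh ?os2
    = B_walk_value (z(a := 3)) ?os2 + A_walk_value (z'(a := 3)) q (a # ps @ [h])"
    unfolding ae be .
  have e: "map (\<lambda>b. (b, (z'(h := 3)) b)) ?P = ?os3" using dP by (auto simp: fun_upd_apply)
  have rv: "B_walk_value ?f2 ?os3 = - B_walk_value (z'(h := 3)) ?os1"
    using B_walk_value_rev[of "rev ?P" "z'(h := 3)" q, unfolded rev_rev_ident b1' e] dP by simp
  have o: "winding z z' (a # cs) = - right_of (z(a := 3)) * lvl (z a) + B_walk_value (z(a := 3)) ?os2 + right_of (z'(a := 3)) * lvl (z' a)"
    using winding_B_walk[OF assms(1) cy2] winding_rotate1[OF assms(1) alt_cycle] by simp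
  have "z' h = z h" using z'P by simp
  then show "- right_of (z(h := 3)) * lvl (z h) + B_walk_value (z(h := 3)) (lasso_ops z z' q a ps cs)
      + right_of (z'(h := 3)) * lvl (z h) = winding z z' (a # cs)"
    using t1 t2 a1 a2 r rv o bv by simp
qed

text \<open>
  The A-walk around one cycle commutes with the lasso around the other one, whose path ends at the gap.
\<close>

lemma winding_dumbbell:
  assumes x: "perfect x" and J: "alt_cycle x y (h # js)" and C: "alt_cycle x x' (a # cs)"
    and CJ: "set (h # js) \<inter> set (a # cs) = {}"
    and ps: "distinct ps" "set ps \<subseteq> A" "set ps \<inter> (set (h # js) \<union> set (a # cs)) = {}"
    and q3: "\<forall>b\<in>set (a # ps). q b < 3" and P: "successively (arc x q) (a # ps @ [h])"
  defines "y' \<equiv> switch x' y (set (h # js))"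
  shows "winding x y (h # js) + winding y y' (a # cs) = winding x x' (a # cs) + winding x' y' (h # js)"
proof -
  let ?J = "h # js" and ?C = "a # cs"
  \<comment> \<open>The A-walk around this cycle starts with the gap at \<open>h\<close> and ends
    with it at \<open>d\<close>. The \<open>y\<close>-partner of \<open>d\<close> is the
    \<open>x\<close>-partner of \<open>h\<close>, so with respect to \<open>y\<close> the same
    connecting path leads to \<open>d\<close>.\<close>
  define d where "d = last ?J"
  have dJ: "d \<in> set ?J" unfolding d_def by simp
  have py: "perfect y" using alt_cycle_perfect[OF x J] .
  have offy: "\<forall>b. b \<notin> set ?J \<longrightarrow> y b = x b" and offx': "\<forall>b. b \<notin> set ?C \<longrightarrow> x' b = x b"
    and sJ: "successively (arc x y) (?J @ [h])" and dJs: "distinct ?J" "set ?J \<subseteq> A"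
    and dC: "distinct ?C" "set ?C \<subseteq> A"
    using J C unfolding alt_cycle_def by auto
  have cy': "alt_cycle x' y' ?J" unfolding y'_def by (rule alt_cycle_disjoint[OF J C CJ])
  have "switch x' y (set ?J) = switch y x' (set ?C)"
    using offy offx' CJ by (auto simp: switch_def fun_eq_iff)
  then have cyC: "alt_cycle y y' ?C" unfolding y'_def using alt_cycle_disjoint[OF C J] CJ by auto
  have dP: "distinct (a # ps @ [h])" "distinct (a # ps @ [d])"
    using ps CJ dJ by auto
  let ?OS = "lasso_ops x x' q a ps cs"
  have P2: "successively (arc y q) (a # ps @ [d])"
  proof -
    have "successively (arc x y) (?J @ [h])" using sJ .
    then have "arc x y d h" unfolding d_def by (simp only: successively_append_iff) simp
    then have dh: "p (y d) d = p (x h) h" unfolding arc_def .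
    have "arc x q (last (a # ps)) h" using P successively_append_iff[of "arc x q" "a # ps" "[h]"] by simp
    then have "arc y q (last (a # ps)) d" using dh unfolding arc_def by simp
    moreover have "successively (arc x q) (a # ps)"
      using P successively_appendD1[of _ "a # ps"] by simp
    then have "successively (arc y q) (a # ps)"
      by (rule successively_tl_mono) (use ps offy in \<open>auto simp: arc_def\<close>)
    ultimately show ?thesis
      using successively_append_iff[of "arc y q" "a # ps" "[d]"] by simp
  qed
  have OS2: "lasso_ops y y' q a ps cs = ?OS"
    unfolding lasso_ops_def y'_def using CJ ps by (auto simp: switch_def)
  have L1: "- right_of (x(h := 3)) * lvl (x h) + B_walk_value (x(h := 3)) ?OS + right_of (x'(h := 3)) * lvl (x h) = winding x x' ?C"
    by (rule lasso_winding[OF x C dP(1)]) (use ps dJs CJ q3 P in auto)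
  have L1b: "B_walk (x(h := 3)) (p (x h) h) ?OS"
    by (rule lasso_B_walk[OF x C dP(1)]) (use ps dJs CJ q3 P in auto)
  have L1e: "B_walk_end (x(h := 3)) ?OS = x'(h := 3)"
    by (rule lasso_end[OF x C dP(1)]) (use ps dJs CJ q3 P in auto)
  have dd: "d \<in> A" "d \<notin> set ?C" "d \<notin> set ps" using dJ dJs CJ ps by auto
  have L2: "- right_of (y(d := 3)) * lvl (y d) + B_walk_value (y(d := 3)) ?OS + right_of (y'(d := 3)) * lvl (y d) = winding y y' ?C"
    unfolding OS2[symmetric]
    by (rule lasso_winding[OF py cyC dP(2)]) (use ps dd q3 P2 in auto)
  obtain ks e where ks: "?J = ks @ [e]" by (metis list.discI rev_exhaust)
  have e: "e = d" unfolding d_def ks by simp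
  have ae: "A_walk_end (x(h := 3)) y ?J = y(d := 3)"
  proof -
    have "hd (ks @ [e]) = h" using ks by (metis list.sel(1))
    then have "A_walk_end (x(h := 3)) y (ks @ [e]) = (switch x y (set ks))(e := 3)"
      using A_walk_end_path[of ks e x y] dJs(1) unfolding ks by simp
    moreover have "set ?J = insert e (set ks)" unfolding ks by simp
    then have "(switch x y (set ks))(e := 3) = y(e := 3)"
      using offy by (auto simp: switch_def fun_upd_apply fun_eq_iff)
    ultimately show ?thesis unfolding ks e by simp
  qed
  have "A_walk_value (x(h := 3)) y ?J + B_walk_value (A_walk_end (x(h := 3)) y ?J) ?OS
    = B_walk_value (x(h := 3)) ?OS + A_walk_value (B_walk_end (x(h := 3)) ?OS) y ?J"
  proof (rule A_walk_B_walk[OF near_perfect_remove[OF x] L1b])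
    show "A_walk (x(h := 3)) y ?J"
    proof (rule A_walk_path)
      show "\<forall>a\<in>set (butlast ?J). y a < 3" using J in_set_butlastD unfolding alt_cycle_def by metis
      show "successively (arc x y) ?J" using sJ by (simp only: successively_append_iff)
    qed (use dJs in auto)
    show "set js \<inter> fst ` set ?OS = {}" "h \<notin> fst ` set ?OS"
      unfolding lasso_ops_def using CJ ps by (auto simp: image_image)
  qed (use dJs in auto)
  then have r: "A_walk_value (x(h := 3)) y ?J + B_walk_value (y(d := 3)) ?OS = B_walk_value (x(h := 3)) ?OS + A_walk_value (x'(h := 3)) y ?J"
    unfolding ae L1e .
  have av: "A_walk_value f y ?J = A_walk_value f y' ?J" for f
    by (rule A_walk_value_cong) (simp add: y'_def switch_def)
  have o1: "winding x y ?J = - right_of (x(h := 3)) * lvl (x h) + A_walk_value (x(h := 3)) y ?J + right_of (y(d := 3)) * lvl (y d)"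
    using winding_A_walk_cycle[OF J] unfolding d_def .
  have o2: "winding x' y' ?J = - right_of (x'(h := 3)) * lvl (x' h) + A_walk_value (x'(h := 3)) y' ?J + right_of (y'(d := 3)) * lvl (y' d)"
    using winding_A_walk_cycle[OF cy'] unfolding d_def .
  have "y' d = y d" "x' h = x h" using dJ offx' CJ by (auto simp: y'_def switch_def)
  then show ?thesis using o1 o2 L1 L2 r av by simp
qed

end

section \<open>Cycles and ears of negative weight\<close>

text \<open>If the orbit of some point has nonnegative weight, removing it leaves a smaller
  invariant set that still has negative weight.\<close>

lemma neg_orbit:
  fixes w :: "'a \<Rightarrow> int"
  assumes "permutation f" "finite S" "f ` S = S" "sum w S < 0"
  shows "\<exists>J. J \<noteq> [] \<and> distinct J \<and> set J \<subseteq> S \<and> successively (\<lambda>a b. b = f a) (J @ [hd J])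
    \<and> sum_list (map w J) < 0"
  using assms(2-4)
proof (induction "card S" arbitrary: S rule: less_induct)
  case less
  obtain a where a: "a \<in> S" using less.prems(3) by fastforce
  obtain n where n: "f ^^ n = id" "0 < n" using permutation_is_nilpotent[OF assms(1)] by auto
  define k where "k = (LEAST k. 0 < k \<and> (f ^^ k) a = a)"
  have k: "0 < k" "(f ^^ k) a = a"
    using LeastI[of "\<lambda>k. 0 < k \<and> (f ^^ k) a = a" n] n unfolding k_def by auto
  have kmin: "(f ^^ j) a \<noteq> a" if "0 < j" "j < k" for j
    using not_less_Least[of j "\<lambda>k. 0 < k \<and> (f ^^ k) a = a"] that unfolding k_def by auto
  have inj: "inj f" using assms(1) permutation_bijective bij_is_inj by blast
  let ?J = "map (\<lambda>i. (f ^^ i) a) [0..<k]"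
  have mem: "(f ^^ i) a \<in> S" for i using a less.prems(2) by (induction i) auto
  have dist: "distinct ?J"
  proof -
    have "(f ^^ i) a \<noteq> (f ^^ j) a" if "i < j" "j < k" for i j
    proof
      assume e: "(f ^^ i) a = (f ^^ j) a"
      have "(f ^^ j) a = (f ^^ i) ((f ^^ (j - i)) a)"
        using that by (metis add_diff_inverse_nat comp_apply funpow_add less_imp_le not_less)
      then have "a = (f ^^ (j - i)) a"
        using e inj_fn[OF inj, of i] by (metis injD)
      moreover have "0 < j - i" "j - i < k" using that by linarith+
      ultimately show False using kmin[of "j - i"] by metis
    qed
    then show ?thesis unfolding distinct_map
      by (auto simp: inj_on_def) (metis nat_neq_iff)
  qed
  have hd: "hd ?J = a" using k(1) by (simp add: hd_map)
  have succ: "successively (\<lambda>a b. b = f a) (?J @ [hd ?J])"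
  proof -
    have "?J @ [hd ?J] = map (\<lambda>i. (f ^^ i) a) [0..<Suc k]" using k(2) hd by simp
    then show ?thesis unfolding successively_conv_nth by (auto simp del: upt_Suc)
  qed
  have im: "f ` set ?J = set ?J"
  proof -
    have "f ` set ?J \<subseteq> set ?J"
    proof
      fix b assume "b \<in> f ` set ?J"
      then obtain i where i: "i < k" "b = (f ^^ Suc i) a" by auto
      show "b \<in> set ?J"
      proof (cases "Suc i = k")
        case True
        then show ?thesis using i k by (auto intro!: image_eqI[of _ _ 0])
      next
        case False
        then show ?thesis using i by (auto intro!: image_eqI[of _ _ "Suc i"])
      qed
    qed
    then show ?thesis
      by (intro endo_inj_surj inj_on_subset[OF inj]) auto
  qed
  show ?case
  proof (cases "sum_list (map w ?J) < 0")
    case True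
    then show ?thesis using dist succ mem k(1) by (intro exI[of _ ?J]) auto
  next
    case False
    let ?S = "S - set ?J"
    have sub: "set ?J \<subseteq> S" using mem by auto
    have "sum w S = sum w (set ?J) + sum w ?S"
      using sum.subset_diff[OF sub less.prems(1), of w] by simp
    moreover have "sum w (set ?J) = sum_list (map w ?J)"
      using dist sum_list_distinct_conv_sum_set by metis
    ultimately have neg: "sum w ?S < 0" using less.prems(3) False by linarith
    have "a \<in> set ?J" using k(1) by (auto intro!: image_eqI[of _ _ 0])
    then have lt: "card ?S < card S" using a less.prems(1) by (intro psubset_card_mono) auto
    have "f ` ?S = ?S" using im less.prems(2) inj by (simp only: image_set_diff)
    from less.hyps[OF lt _ this neg] less.prems(1) show ?thesis by blast
  qed
qed

text \<open>The list is cut at its first return to \<open>C\<close>. If that segment costs at least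
  the difference of potential, the remainder inherits the deficit.\<close>

lemma neg_segment:
  fixes w \<pi> :: "'a \<Rightarrow> int"
  assumes "s \<in> C" "ls \<noteq> []" "last ls \<in> C"
    "sum_list (map w (butlast (s # ls))) < \<pi> (last ls) - \<pi> s"
  shows "\<exists>pre r Es q post. s # ls = pre @ r # Es @ q # post \<and> r \<in> C \<and> q \<in> C \<and> set Es \<inter> C = {}
    \<and> sum_list (map w (r # Es)) < \<pi> q - \<pi> r"
  using assms
proof (induction "length ls" arbitrary: s ls rule: less_induct)
  case less
  have "\<exists>q\<in>set ls. q \<in> C" using less.prems(2,3) last_in_set by blast
  then obtain Es q post where e: "ls = Es @ q # post" "q \<in> C" "\<forall>y\<in>set Es. y \<notin> C"
    using split_list_first_prop[of ls "\<lambda>q. q \<in> C"] by blast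
  show ?case
  proof (cases "sum_list (map w (s # Es)) < \<pi> q - \<pi> s")
    case True
    have "s # ls = [] @ s # Es @ q # post" using e by simp
    then show ?thesis using True e less.prems(1) by blast
  next
    case False
    have ne: "post \<noteq> []" using False less.prems(4) e by (auto simp: butlast_append)
    have "sum_list (map w (butlast (s # ls))) = sum_list (map w (s # Es)) + sum_list (map w (butlast (q # post)))"
      using e ne by (simp add: butlast_append)
    then have lt: "sum_list (map w (butlast (q # post))) < \<pi> (last post) - \<pi> q"
      using False less.prems(4) e ne by simp
    have "last post \<in> C" using less.prems(3) e ne by simp
    from less.hyps[OF _ e(2) ne this lt] e(1)
    obtain pre r Fs q' post' where r: "q # post = pre @ r # Fs @ q' # post'" "r \<in> C" "q' \<in> C"
      "set Fs \<inter> C = {}" "sum_list (map w (r # Fs)) < \<pi> q' - \<pi> r" by auto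
    have "s # ls = (s # Es @ pre) @ r # Fs @ q' # post'" using e r by simp
    then show ?thesis using r by blast
  qed
qed

lemma takeWhile_first: "q \<notin> set us \<Longrightarrow> takeWhile (\<lambda>a. a \<noteq> q) (us @ q # vs) = us"
  by (induction us) auto

text \<open>The weight of the stretch of the cycle from \<open>q\<close> to \<open>r\<close> is a
  difference of partial sums even when the stretch passes the end of the list, because the total
  weight is \<open>0\<close>.\<close>

lemma rotate_segment:
  fixes w :: "'a \<Rightarrow> int"
  assumes "distinct cs" "r \<in> set cs" "q \<in> set cs" "sum_list (map w cs) = 0"
  shows "\<exists>us vs Q Cs. cs = us @ vs \<and> vs @ us = Q @ r # Cs \<and> hd (Q @ [r]) = q \<and>
    sum_list (map w Q) = sum_list (map w (takeWhile (\<lambda>a. a \<noteq> r) cs)) - sum_list (map w (takeWhile (\<lambda>a. a \<noteq> q) cs))"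
proof -
  obtain us vs where uv: "cs = us @ q # vs" "q \<notin> set us" using split_list_first[OF assms(3)] by blast
  have tq: "takeWhile (\<lambda>a. a \<noteq> q) cs = us"
    using uv by (simp add: takeWhile_first)
  show ?thesis
  proof (cases "r \<in> set us")
    case True
    obtain Q Cs where Q: "us = Q @ r # Cs" "r \<notin> set Q" using split_list_first[OF True] by blast
    have tr: "takeWhile (\<lambda>a. a \<noteq> r) cs = Q" using uv Q by (simp add: takeWhile_first)
    show ?thesis unfolding tq tr
      by (intro exI[of _ us] exI[of _ "q # vs"] exI[of _ "q # vs @ Q"] exI[of _ Cs])
        (use assms(4) uv Q in auto)
  next
    case False
    then have "r \<in> set (q # vs)" using assms(2) uv by auto
    then obtain Q Cs where Q: "q # vs = Q @ r # Cs" "r \<notin> set Q" using split_list_first by metis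
    have tr: "takeWhile (\<lambda>a. a \<noteq> r) cs = us @ Q"
      using uv(1) Q False takeWhile_first[of r "us @ Q" Cs] by simp
    have "hd (Q @ [r]) = q" using Q(1) by (cases Q) auto
    then show ?thesis unfolding tq tr
      by (intro exI[of _ us] exI[of _ "q # vs"] exI[of _ Q] exI[of _ "Cs @ us"])
        (use uv Q in auto)
  qed
qed

context three_matchings
begin

text \<open>Following the edge of \<open>y\<close> and then the edge of \<open>x\<close> back
  permutes \<open>A\<close>. The orbits of this permutation are alternating cycles, and one of them
  has negative weight.\<close>

lemma neg_cycle:
  fixes w :: "'a \<Rightarrow> int"
  assumes "perfect x" "perfect y" "sum w A < 0"
  shows "\<exists>J. alt_cycle x (switch x y (set J)) J \<and> sum_list (map w J) < 0"
proof -
  let ?X = "\<lambda>a. p (x a) a" and ?Y = "\<lambda>a. p (y a) a"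
  have bX: "bij_betw ?X A B" and bY: "bij_betw ?Y A B" using assms unfolding perfect_def by auto
  let ?f = "\<lambda>a. if a \<in> A then the_inv_into A ?X (?Y a) else a"
  have bf: "bij_betw ?f A A"
    using bij_betw_trans[OF bY bij_betw_the_inv_into[OF bX]]
    by (rule bij_betw_cong[THEN iffD1, rotated]) auto
  then have "?f permutes A" by (rule bij_imp_permutes) auto
  then have perm: "permutation ?f" using fin permutation_permutes by blast
  obtain J where J: "J \<noteq> []" "distinct J" "set J \<subseteq> A" "successively (\<lambda>a b. b = ?f a) (J @ [hd J])"
    "sum_list (map w J) < 0"
    using neg_orbit[OF perm fin _ assms(3)] bf unfolding bij_betw_def by blast
  have "?X (?f a) = ?Y a" if "a \<in> A" for a
    using that f_the_inv_into_f_bij_betw[OF bX, of "?Y a"] bY bij_betwE by fastforce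
  then have "successively (arc x (switch x y (set J))) (J @ [hd J])"
    using J(1-3)
    by (intro successively_mono[OF J(4)]) (auto simp: arc_def switch_def)
  then have "alt_cycle x (switch x y (set J)) J"
    using J assms(1,2) unfolding alt_cycle_def perfect_def by (auto simp: switch_def)
  then show ?thesis using J(5) by blast
qed

text \<open>
  As \<open>wC\<close> has total weight \<open>0\<close>, its partial sums are a potential on the cycle \<open>cs\<close>. If every segment of \<open>js\<close> between
  visits to \<open>cs\<close> cost at least the potential difference, then \<open>js\<close> would have nonnegative weight.
\<close>

lemma neg_ear:
  fixes wC wJ :: "'a \<Rightarrow> int"
  assumes C: "alt_cycle x y cs" and J: "alt_cycle x y0 js" and meet: "set js \<inter> set cs \<noteq> {}"
    and wC: "sum_list (map wC cs) = 0" and wJ: "sum_list (map wJ js) < 0"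
  shows "\<exists>us vs Q r Cs Es z. cs = us @ vs \<and> vs @ us = Q @ r # Cs \<and> theta x y z Q r Cs Es
    \<and> (\<forall>a\<in>set (r # Es). z a = y0 a) \<and> sum_list (map wC Q) + sum_list (map wJ (r # Es)) < 0"
proof -
  obtain s where s: "s \<in> set js" "s \<in> set cs" using meet by auto
  obtain l1 l2 where l: "js = l1 @ s # l2" using s(1) split_list by metis
  let ?ls = "l2 @ l1 @ [s]"
  have cJ: "alt_cycle x y0 (s # l2 @ l1)" using alt_cycle_rotate[of x y0 l1 "s # l2"] J l by simp
  define \<pi> where "\<pi> a = sum_list (map wC (takeWhile (\<lambda>b. b \<noteq> a) cs))" for a
  have "sum_list (map wJ (butlast (s # ?ls))) < \<pi> (last ?ls) - \<pi> s"
    using wJ l by (simp add: butlast_append)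
  then obtain pre r Es q post where e: "s # ?ls = pre @ r # Es @ q # post" "r \<in> set cs" "q \<in> set cs"
    "set Es \<inter> set cs = {}" "sum_list (map wJ (r # Es)) < \<pi> q - \<pi> r"
    using neg_segment[of s "set cs" ?ls wJ \<pi>] s by auto
  have dc: "distinct cs" "set cs \<subseteq> A" using C unfolding alt_cycle_def by auto
  obtain us vs Q Cs where u: "cs = us @ vs" "vs @ us = Q @ r # Cs" "hd (Q @ [r]) = q"
    "sum_list (map wC Q) = \<pi> r - \<pi> q"
    using rotate_segment[OF dc(1) e(2,3) wC] unfolding \<pi>_def by blast
  \<comment> \<open>The second cycle of the theta graph follows \<open>cs\<close> along
    \<open>Q\<close> and then the ear \<open>r # Es\<close> of \<open>js\<close>.\<close>
  define z where "z a = (if a \<in> set Q then y a else if a \<in> set (r # Es) then y0 a else x a)" for a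
  have set_cs: "set cs = set (Q @ r # Cs)" using u(1,2) by (metis set_append sup_commute)
  have cC: "alt_cycle x y (Q @ r # Cs)" using alt_cycle_rotate[of x y us vs] C u(1,2) by simp
  then have dQ: "distinct (Q @ r # Cs)" unfolding alt_cycle_def by auto
  have "butlast (s # ?ls) = s # l2 @ l1" by (simp add: butlast_append)
  moreover have "butlast (s # ?ls) = pre @ r # Es @ butlast (q # post)" unfolding e(1) by (simp add: butlast_append)
  ultimately have jl: "s # l2 @ l1 = pre @ r # Es @ butlast (q # post)" by simp
  have dE: "distinct (r # Es)" "set (r # Es) \<subseteq> A" "\<forall>a\<in>set (r # Es). y0 a < 3"
    using cJ unfolding alt_cycle_def jl by auto
  have sub: "r \<notin> set Q" "set Es \<inter> set Q = {}" "set Q \<subseteq> A" using dQ e(4) set_cs dc(2) by auto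
  have "successively (arc x y0) (s # ?ls)" using cJ unfolding alt_cycle_def by simp
  then have "successively (arc x y0) (pre @ (r # Es @ [q]) @ post)" unfolding e(1) by simp
  then have "successively (arc x y0) (r # Es @ [q])" by (simp only: successively_append_iff)
  then have s1: "successively (arc x y0) ((r # Es) @ [q])" by simp
  have 1: "successively (arc x z) ((r # Es) @ [q])"
  proof -
    have "successively (arc x z) (r # Es)"
      by (rule successively_mono[OF successively_appendD1[OF s1]]) (use sub in \<open>auto simp: arc_def z_def\<close>)
    moreover have "arc x y0 (last (r # Es)) q"
      using s1 unfolding successively_append_iff[of _ "r # Es" "[q]"] by simp
    moreover obtain l where "l = last (r # Es)" "l \<in> set (r # Es)"
      using last_in_set[of "r # Es"] by blast
    moreover have "l \<in> set (r # Es) \<Longrightarrow> z l = y0 l" for l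
      using sub by (auto simp: z_def)
    ultimately have "successively (arc x z) (r # Es)" "arc x z (last (r # Es)) q"
      unfolding arc_def by auto
    then show ?thesis unfolding successively_append_iff[of _ "r # Es" "[q]"] by simp
  qed
  have 2: "successively (arc x z) (Q @ [r])"
  proof -
    have "successively (arc x y) (Q @ r # Cs @ [hd (Q @ r # Cs)])" using cC unfolding alt_cycle_def by simp
    then have s2: "successively (arc x y) (Q @ [r])"
      using successively_appendD1[of _ "Q @ [r]"] by simp
    have "successively (arc x z) Q"
      by (rule successively_mono[OF successively_appendD1[OF s2]]) (auto simp: arc_def z_def)
    moreover have "Q \<noteq> [] \<Longrightarrow> arc x z (last Q) r"
      using s2 unfolding successively_append_iff arc_def z_def by auto
    ultimately show ?thesis unfolding successively_append_iff by auto
  qed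
  have hd: "hd (Q @ r # Es) = q" using u(3) by (cases Q) auto
  have "successively (arc x z) ((Q @ r # Es) @ [hd (Q @ r # Es)])"
    using successively_glue[OF 2, of "Es @ [q]"] 1 unfolding hd by simp
  then have "alt_cycle x z (Q @ r # Es)"
    using dE dQ sub cC cJ jl dc(2) unfolding alt_cycle_def by (auto simp: z_def)
  moreover have "set Cs \<inter> set Es = {}" using e(4) set_cs by auto
  ultimately have "theta x y z Q r Cs Es" using cC unfolding theta_def by (auto simp: z_def)
  moreover have "\<forall>a\<in>set (r # Es). z a = y0 a" using sub by (auto simp: z_def)
  moreover have "sum_list (map wC Q) + sum_list (map wJ (r # Es)) < 0" using u(4) e(5) by simp
  ultimately show ?thesis using u(1,2) by blast
qed

text \<open>Connectivity: equal images under the three bijections mean that no edge leaves the vertex set.\<close>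

definition indecomposable :: bool where
  "indecomposable \<longleftrightarrow> (\<forall>U \<subseteq> A. U \<noteq> {} \<longrightarrow> p 0 ` U = p 1 ` U \<longrightarrow> p 0 ` U = p 2 ` U \<longrightarrow> U = A)"

lemma path_colors:
  assumes "successively (\<lambda>a b. \<exists>j<3. p j a = p (x b) b) (as @ [h])" "distinct as"
  shows "\<exists>q. (\<forall>b\<in>set as. q b < 3) \<and> successively (arc x q) (as @ [h])"
  using assms
proof (induction as)
  case (Cons a as)
  obtain b bs where b: "as @ [h] = b # bs" by (cases "as @ [h]") auto
  have "successively (\<lambda>a b. \<exists>j<3. p j a = p (x b) b) (as @ [h])" "\<exists>j<3. p j a = p (x b) b"
    using Cons.prems(1) b by auto
  then obtain q j where q: "\<forall>b\<in>set as. q b < 3" "successively (arc x q) (as @ [h])" and j: "j < 3" "p j a = p (x b) b"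
    using Cons by auto
  have "successively (arc x (q(a := j))) (as @ [h])"
  proof -
    have 1: "successively (arc x (q(a := j))) as"
      by (rule successively_mono[OF successively_appendD1[OF q(2)]])
        (use Cons.prems(2) in \<open>auto simp: arc_def fun_upd_apply\<close>)
    have "as \<noteq> [] \<Longrightarrow> last as \<noteq> a" using Cons.prems(2) last_in_set by auto
    then show ?thesis using 1 q(2) unfolding successively_append_iff by (auto simp: arc_def fun_upd_apply)
  qed
  then show ?case using j q(1) b
    by (intro exI[of _ "q(a := j)"]) (auto simp: arc_def fun_upd_apply)
qed auto

text \<open>The set \<open>U\<close> reachable from \<open>C\<close> has all its neighbors among its
  own \<open>x\<close>-partners, and by cardinality each color maps it onto them; hence
  \<open>U = A\<close>. A shortest connection then repeats no vertex and meets \<open>C\<close> and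
  \<open>J\<close> only at its ends.\<close>

lemma join_path:
  assumes indecomposable "perfect x" "C \<noteq> {}" "C \<subseteq> A" "J \<noteq> {}" "J \<subseteq> A" "C \<inter> J = {}"
  shows "\<exists>a ps h q. a \<in> C \<and> h \<in> J \<and> distinct ps \<and> set ps \<subseteq> A \<and> set ps \<inter> (C \<union> J) = {}
    \<and> (\<forall>b\<in>set (a # ps). q b < 3) \<and> successively (arc x q) (a # ps @ [h])"
proof -
  define E where "E a b \<longleftrightarrow> (\<exists>j<3. p j a = p (x b) b)" for a b
  define r where "r = {(a, b). a \<in> A \<and> b \<in> A \<and> E a b}"
  define U where "U = r\<^sup>* `` C"
  have UA: "U \<subseteq> A" unfolding U_def
  proof
    fix b assume "b \<in> r\<^sup>* `` C"
    then obtain a where "a \<in> C" "(a, b) \<in> r\<^sup>*" by auto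
    from this(2,1) show "b \<in> A" by (induction rule: rtrancl_induct) (use assms(4) r_def in auto)
  qed
  have CU: "C \<subseteq> U" unfolding U_def by auto
  let ?X = "\<lambda>a. p (x a) a"
  have bX: "bij_betw ?X A B" using assms(2) unfolding perfect_def by auto
  have eq: "p j ` U = ?X ` U" if "j < 3" for j
  proof (rule card_subset_eq)
    show "p j ` U \<subseteq> ?X ` U"
    proof
      fix c assume "c \<in> p j ` U"
      then obtain u where u: "u \<in> U" "c = p j u" by auto
      then have "c \<in> B" using UA p_mem that by auto
      then obtain b where b: "b \<in> A" "c = ?X b" using bX unfolding bij_betw_def by auto
      have "(u, b) \<in> r" unfolding r_def E_def using u b UA that by auto
      then have "b \<in> U" using u(1) unfolding U_def by (auto intro: rtrancl_into_rtrancl)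
      then show "c \<in> ?X ` U" using b by auto
    qed
    have "card (p j ` U) = card U" "card (?X ` U) = card U"
      using bij[OF that] bX UA by (auto intro!: card_image simp: bij_betw_def inj_on_subset)
    then show "card (p j ` U) = card (?X ` U)" by simp
    show "finite (?X ` U)" using finite_subset[OF UA fin] by simp
  qed
  have "p 0 ` U = p 1 ` U" "p 0 ` U = p 2 ` U" using eq[of 0] eq[of 1] eq[of 2] by simp_all
  moreover have "U \<noteq> {}" using CU assms(3) by blast
  ultimately have UA_eq: "U = A"
    using assms(1)[unfolded indecomposable_def, THEN spec, of U] UA by simp
  obtain h where h: "h \<in> J" using assms(5) by blast
  then have "h \<in> U" using assms(6) UA_eq by blast
  obtain a where ah: "a \<in> C" "(a, h) \<in> r\<^sup>*"
    using \<open>h \<in> U\<close> unfolding U_def by (rule ImageE)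
  define good where "good L \<longleftrightarrow> L \<noteq> [] \<and> hd L \<in> C \<and> last L \<in> J \<and> set L \<subseteq> A \<and> successively E L" for L
  have "\<exists>L. L \<noteq> [] \<and> hd L = a \<and> last L \<in> J \<and> set L \<subseteq> A \<and> successively E L"
    using ah(2)
  proof (induction rule: converse_rtrancl_induct)
    case base
    then show ?case using h assms(6) by (intro exI[of _ "[h]"]) auto
  next
    case (step y z)
    then obtain L where "L \<noteq> []" "hd L = z" "last L \<in> J" "set L \<subseteq> A" "successively E L" by auto
    then show ?case using step(1) unfolding r_def
      by (intro exI[of _ "y # L"]) (auto simp: successively_Cons)
  qed
  then have "\<exists>L. good L" unfolding good_def using ah(1) by auto
  then obtain L where L: "good L" "\<And>L'. good L' \<Longrightarrow> length L \<le> length L'"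
    using ex_has_least_nat[of good _ length] by auto
  have "hd L \<noteq> last L" using L(1) assms(7) unfolding good_def by auto
  moreover obtain a L1 where L1: "L = a # L1" using L(1) unfolding good_def by (cases L) auto
  ultimately have "L1 \<noteq> []" by auto
  then obtain ps h where e: "L = a # ps @ [h]" using L1 by (cases L1 rule: rev_cases) auto
  have g: "a \<in> C" "h \<in> J" "set ps \<subseteq> A" "a \<in> A" "h \<in> A" "successively E (a # ps @ [h])"
    using L(1) unfolding good_def e by auto
  have C: "set ps \<inter> C = {}"
  proof (rule ccontr)
    assume "set ps \<inter> C \<noteq> {}"
    then obtain b where b: "b \<in> set ps" "b \<in> C" by auto
    obtain l1 l2 where l: "ps = l1 @ b # l2" using split_list[OF b(1)] by auto
    have "successively E ((a # l1) @ (b # l2 @ [h]))" using g(6) l by simp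
    then have "successively E (b # l2 @ [h])" by (simp only: successively_append_iff)
    then have "good (b # l2 @ [h])" unfolding good_def using b g l by auto
    from L(2)[OF this] show False unfolding e l by simp
  qed
  have J: "set ps \<inter> J = {}"
  proof (rule ccontr)
    assume "set ps \<inter> J \<noteq> {}"
    then obtain b where b: "b \<in> set ps" "b \<in> J" by auto
    obtain l1 l2 where l: "ps = l1 @ b # l2" using split_list[OF b(1)] by auto
    have "successively E ((a # l1 @ [b]) @ (l2 @ [h]))" using g(6) l by simp
    then have "successively E (a # l1 @ [b])" by (rule successively_appendD1)
    then have "good (a # l1 @ [b])" unfolding good_def using b g l by auto
    from L(2)[OF this] show False unfolding e l by simp
  qed
  have dist: "distinct ps"
  proof (rule ccontr)
    assume "\<not> distinct ps"
    then obtain l1 b l2 l3 where l: "ps = l1 @ [b] @ l2 @ [b] @ l3" using not_distinct_decomp by blast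
    have s: "successively E ((a # l1 @ [b]) @ (l2 @ b # l3 @ [h]))"
      "successively E ((a # l1 @ b # l2) @ (b # l3 @ [h]))" using g(6) l by simp_all
    have "successively E ((a # l1) @ [b])" using successively_appendD1[OF s(1)] by simp
    moreover have "successively E (b # l3 @ [h])" using s(2) by (simp only: successively_append_iff)
    ultimately have "successively E (((a # l1) @ [b]) @ (l3 @ [h]))" by (rule successively_glue)
    then have "good (a # l1 @ b # l3 @ [h])" unfolding good_def using g l by auto
    from L(2)[OF this] show False unfolding e l by simp
  qed
  have "a \<notin> set ps" using C g(1) by auto
  then have "distinct (a # ps)" using dist by simp
  moreover have "successively (\<lambda>a b. \<exists>j<3. p j a = p (x b) b) ((a # ps) @ [h])"
    using g(6) unfolding E_def by simp
  ultimately obtain q where "\<forall>b\<in>set (a # ps). q b < 3" "successively (arc x q) ((a # ps) @ [h])"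
    using path_colors by blast
  then show ?thesis using g C J dist by (intro exI[of _ a] exI[of _ ps] exI[of _ h] exI[of _ q]) auto
qed

end

section \<open>The descent\<close>

text \<open>
  The second coordinate at abscissa \<open>t + 1/2\<close> of the segment from \<open>(a, b)\<close> to \<open>(c, d)\<close>.
\<close>

definition height :: "int \<Rightarrow> int \<Rightarrow> int \<Rightarrow> int \<Rightarrow> int \<Rightarrow> real" where
  "height t a b c d = (b * (c - (t + 1/2)) + d * ((t + 1/2) - a)) / (c - a)"

text \<open>Both ends of the new segment lie on or below the line through the old one, and one lies
  strictly below. At the half-integral abscissa both ends enter with positive weight.\<close>

lemma height_less:
  fixes f0 fk g0 gk x0 xk y0 yk t :: int
  assumes x: "x0 \<le> t" "t < y0" and f: "f0 \<le> t" "t < g0"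
    and le: "(y0 - x0) * fk - (yk - xk) * f0 \<le> (y0 - x0) * xk - (yk - xk) * x0"
      "(y0 - x0) * gk - (yk - xk) * g0 \<le> (y0 - x0) * xk - (yk - xk) * x0"
    and lt: "(y0 - x0) * fk - (yk - xk) * f0 < (y0 - x0) * xk - (yk - xk) * x0
      \<or> (y0 - x0) * gk - (yk - xk) * g0 < (y0 - x0) * xk - (yk - xk) * x0"
  shows "height t f0 fk g0 gk < height t x0 xk y0 yk"
proof -
  define h :: real where "h = t + 1/2"
  define l where "l b a = real_of_int ((y0 - x0) * b - (yk - xk) * a)" for b a
  let ?nf = "fk * (g0 - h) + gk * (h - f0)" and ?nx = "xk * (y0 - h) + yk * (h - x0)"
  have "real_of_int f0 \<le> t" "real_of_int t + 1 \<le> g0" using f by linarith+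
  then have pos: "0 < g0 - h" "0 < h - f0" unfolding h_def by linarith+
  have l: "l fk f0 \<le> l xk x0" "l gk g0 \<le> l xk x0" "l fk f0 < l xk x0 \<or> l gk g0 < l xk x0"
    unfolding l_def using le lt by (simp_all only: of_int_le_iff of_int_less_iff)
  have "?nf * (y0 - x0) - ?nx * (g0 - f0) = (l fk f0 - l xk x0) * (g0 - h) + (l gk g0 - l xk x0) * (h - f0)"
    unfolding l_def by (simp add: algebra_simps)
  also have "\<dots> < 0"
    using l(3)
  proof
    assume "l fk f0 < l xk x0"
    then have "(l fk f0 - l xk x0) * (g0 - h) < 0" using pos by (simp add: mult_neg_pos)
    moreover have "(l gk g0 - l xk x0) * (h - f0) \<le> 0" using l(2) pos by (simp add: mult_nonpos_nonneg)
    ultimately show ?thesis by linarith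
  next
    assume "l gk g0 < l xk x0"
    then have "(l gk g0 - l xk x0) * (h - f0) < 0" using pos by (simp add: mult_neg_pos)
    moreover have "(l fk f0 - l xk x0) * (g0 - h) \<le> 0" using l(1) pos by (simp add: mult_nonpos_nonneg)
    ultimately show ?thesis by linarith
  qed
  finally have "?nf * (y0 - x0) < ?nx * (g0 - f0)" by simp
  moreover have "0 < real_of_int (y0 - x0)" "0 < real_of_int (g0 - f0)" using x f by linarith+
  ultimately have "?nf / (g0 - f0) < ?nx / (y0 - x0)"
    by (simp add: pos_divide_less_eq pos_less_divide_eq mult.commute)
  then show ?thesis unfolding height_def h_def by simp
qed

context three_matchings
begin

text \<open>
  With \<open>\<alpha>\<close> and \<open>\<beta>\<close> taken from a pair \<open>(x, y)\<close>, this functional is constant on the line through the vectors of \<open>x\<close> and \<open>y\<close>.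
\<close>

definition tilt :: "int \<Rightarrow> int \<Rightarrow> nat \<Rightarrow> ('a \<Rightarrow> nat) \<Rightarrow> int" where
  "tilt \<alpha> \<beta> k f = \<alpha> * ct f k - \<beta> * ct f 0"

definition tilt_wt :: "int \<Rightarrow> int \<Rightarrow> nat \<Rightarrow> ('a \<Rightarrow> nat) \<Rightarrow> ('a \<Rightarrow> nat) \<Rightarrow> 'a \<Rightarrow> int" where
  "tilt_wt \<alpha> \<beta> k x f a = \<alpha> * (of_bool (f a = k) - of_bool (x a = k)) - \<beta> * (of_bool (f a = 0) - of_bool (x a = 0))"

lemma tilt_switch:
  assumes "distinct as" "set as \<subseteq> A"
  shows "tilt \<alpha> \<beta> k (switch x f (set as)) = tilt \<alpha> \<beta> k x + sum_list (map (tilt_wt \<alpha> \<beta> k x f) as)"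
proof -
  have "sum_list (map (tilt_wt \<alpha> \<beta> k x f) as)
    = \<alpha> * sum_list (map (\<lambda>a. of_bool (f a = k) - of_bool (x a = k)) as)
      - \<beta> * sum_list (map (\<lambda>a. of_bool (f a = 0) - of_bool (x a = 0)) as)"
    unfolding tilt_wt_def by (induction as) (auto simp: algebra_simps)
  then show ?thesis unfolding tilt_def ct_switch[OF assms] by (simp add: algebra_simps)
qed

lemma tilt_sum: "sum (tilt_wt \<alpha> \<beta> k x f) A = tilt \<alpha> \<beta> k f - tilt \<alpha> \<beta> k x"
proof -
  have "sum (tilt_wt \<alpha> \<beta> k x f) A = \<alpha> * (ct f k - ct x k) - \<beta> * (ct f 0 - ct x 0)"
    unfolding tilt_wt_def color_count_def by (simp add: sum_subtractf flip: sum_distrib_left)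
  then show ?thesis unfolding tilt_def by (simp add: algebra_simps)
qed

lemma ct_bounds:
  assumes "perfect x" "i < 3"
  shows "0 \<le> ct x i" "ct x i \<le> int (card A)"
proof -
  show "0 \<le> ct x i" by (rule color_count_nonneg)
  have "i = 0 \<or> i = 1 \<or> i = 2" using assms(2) by auto
  then show "ct x i \<le> int (card A)"
    using perfect_sum[OF assms(1)] color_count_nonneg[of A x 0] color_count_nonneg[of A x 1] color_count_nonneg[of A x 2] by auto
qed

lemma ct_const: "ct (\<lambda>_. j) i = (if j = i then int (card A) else 0)"
  unfolding color_count_def by simp

text \<open>
  Among the pairs with \<open>\<Phi>\<close> take one of minimal height. If it uses color \<open>k\<close>, one of the monochromatic matchings has smaller
  tilt than \<open>x\<close> and \<open>y\<close>, hence so has some alternating cycle; this cycle meets \<open>cs\<close> (theta graph) or not (square), and either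
  way there is a lower pair.
\<close>

lemma descent:
  assumes k: "k = 1 \<or> k = 2"
    and rot: "\<And>x y us vs. perfect x \<Longrightarrow> alt_cycle x y (us @ vs) \<Longrightarrow> \<Phi> x y (us @ vs) \<Longrightarrow> \<Phi> x y (vs @ us)"
    and th_hi: "\<And>x y z Q r Cs Es. perfect x \<Longrightarrow> theta x y z Q r Cs Es \<Longrightarrow> ct x 0 \<le> t \<Longrightarrow> t < ct y 0
      \<Longrightarrow> t < ct z 0 \<Longrightarrow> \<Phi> x y (Q @ r # Cs) \<Longrightarrow> \<Phi> x z (Q @ r # Es)"
    and th_lo: "\<And>x y z Q r Cs Es. perfect x \<Longrightarrow> theta x y z Q r Cs Es \<Longrightarrow> ct x 0 \<le> t \<Longrightarrow> t < ct y 0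
      \<Longrightarrow> ct z 0 \<le> t \<Longrightarrow> \<Phi> x y (Q @ r # Cs) \<Longrightarrow> \<Phi> z y (rev (rev Cs @ r # Es))"
    and sq1: "\<And>x y z w cs js. perfect x \<Longrightarrow> alt_cycle x y cs \<Longrightarrow> alt_cycle x z js \<Longrightarrow> set js \<inter> set cs = {} \<Longrightarrow> w = switch y z (set js)
      \<Longrightarrow> ct x 0 \<le> t \<Longrightarrow> t < ct y 0 \<Longrightarrow> ct z 0 \<le> t \<Longrightarrow> t < ct w 0 \<Longrightarrow> \<Phi> x y cs \<Longrightarrow> \<Phi> z w cs"
    and sq2: "\<And>x y z w cs js. perfect x \<Longrightarrow> alt_cycle x y cs \<Longrightarrow> alt_cycle x z js \<Longrightarrow> set js \<inter> set cs = {} \<Longrightarrow> w = switch y z (set js)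
      \<Longrightarrow> ct x 0 \<le> t \<Longrightarrow> t < ct y 0 \<Longrightarrow> t < ct z 0 \<Longrightarrow> t < ct w 0 \<Longrightarrow> \<Phi> x y cs \<Longrightarrow> \<Phi> x z js"
    and sq3: "\<And>x y z w cs js. perfect x \<Longrightarrow> alt_cycle x y cs \<Longrightarrow> alt_cycle x z js \<Longrightarrow> set js \<inter> set cs = {} \<Longrightarrow> w = switch y z (set js)
      \<Longrightarrow> ct x 0 \<le> t \<Longrightarrow> t < ct y 0 \<Longrightarrow> ct z 0 \<le> t \<Longrightarrow> ct w 0 \<le> t \<Longrightarrow> \<Phi> x y cs \<Longrightarrow> \<Phi> w y (rev js)"
    and start: "perfect x" "alt_cycle x y cs" "ct x 0 \<le> t" "t < ct y 0" "\<Phi> x y cs"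
  shows "\<exists>x y cs. perfect x \<and> alt_cycle x y cs \<and> ct x 0 \<le> t \<and> t < ct y 0 \<and> \<Phi> x y cs \<and> ct x k = 0 \<and> ct y k = 0"
proof -
  define ok where "ok x y cs \<longleftrightarrow> perfect x \<and> alt_cycle x y cs \<and> ct x 0 \<le> t \<and> t < ct y 0 \<and> \<Phi> x y cs" for x y cs
  define H where "H x y = height t (ct x 0) (ct x k) (ct y 0) (ct y k)" for x y
  let ?V = "{H x y |x y cs. ok x y cs}"
  have k3: "k < 3" "k \<noteq> 0" using k by auto
  \<comment> \<open>The heights depend on four counts between \<open>0\<close> and
    \<open>card A\<close> only, so a minimum exists.\<close>
  have "?V \<subseteq> (\<lambda>(a, b, c, d). height t a b c d) ` ({0..int (card A)} \<times> {0..int (card A)} \<times> {0..int (card A)} \<times> {0..int (card A)})"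
  proof
    fix v assume "v \<in> ?V"
    then obtain x y cs where v: "v = H x y" "ok x y cs" by auto
    have "perfect x" "perfect y" using v(2) alt_cycle_perfect unfolding ok_def by auto
    then show "v \<in> (\<lambda>(a, b, c, d). height t a b c d) ` ({0..int (card A)} \<times> {0..int (card A)} \<times> {0..int (card A)} \<times> {0..int (card A)})"
      using ct_bounds k3 unfolding v(1) H_def
      by (intro image_eqI[of _ _ "(ct x 0, ct x k, ct y 0, ct y k)"]) auto
  qed
  then have "finite ?V" by (rule finite_subset) auto
  moreover have "?V \<noteq> {}" using start unfolding ok_def by blast
  ultimately obtain m where m: "m \<in> ?V" "\<forall>v\<in>?V. m \<le> v" using Min_in[of ?V] Min_le[of ?V] by blast
  then obtain x y cs where xy1: "m = H x y" "ok x y cs" by blast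
  have xy2: "H x y \<le> H x' y'" if "ok x' y' cs'" for x' y' cs'
  proof -
    have "H x' y' \<in> ?V" using that by blast
    then show ?thesis using m(2) xy1(1) by simp
  qed
  note xy = xy1(2) xy2
  have px: "perfect x" and C: "alt_cycle x y cs" and lx: "ct x 0 \<le> t" and ly: "t < ct y 0" and Ph: "\<Phi> x y cs"
    using xy(1) unfolding ok_def by auto
  have py: "perfect y" using alt_cycle_perfect[OF px C] .
  define \<alpha> \<beta> where "\<alpha> = ct y 0 - ct x 0" and "\<beta> = ct y k - ct x k"
  have \<alpha>: "0 < \<alpha>" unfolding \<alpha>_def using lx ly by simp
  let ?T = "tilt \<alpha> \<beta> k" and ?W = "tilt_wt \<alpha> \<beta> k x"
  have Ty: "?T y = ?T x" unfolding tilt_def \<alpha>_def \<beta>_def by (simp add: algebra_simps)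
  have less: "False" if "ok f g ds" "?T f \<le> ?T x" "?T g \<le> ?T x" "?T f < ?T x \<or> ?T g < ?T x" for f g ds
  proof -
    have "H f g < H x y"
      unfolding H_def
      by (rule height_less) (use that lx ly in \<open>simp_all add: ok_def tilt_def \<alpha>_def \<beta>_def\<close>)
    then show False using xy(2)[OF that(1)] by simp
  qed
  show ?thesis
  proof (cases "ct x k = 0 \<and> ct y k = 0")
    case True
    then show ?thesis using xy(1) unfolding ok_def by blast
  next
    case False
    define k' where "k' = 3 - k"
    have k': "k' < 3" "k' \<noteq> 0" "k' \<noteq> k" using k unfolding k'_def by auto
    have nn: "0 \<le> ct x 0" "0 \<le> ct x k" "0 \<le> ct y k" by (rule color_count_nonneg)+
    \<comment> \<open>In the coordinates for colors \<open>0\<close> and \<open>k\<close>, a line of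
      slope at least \<open>0\<close> leaves \<open>(card A, 0)\<close> below it, the vector of the
      matching of color \<open>0\<close>. A line of negative slope leaves the origin below it, the
      vector of the matching of color \<open>k'\<close>.\<close>
    have "\<exists>i<3. ?T (\<lambda>_. i) < ?T x"
    proof (cases "0 \<le> \<beta>")
      case True
      have "ct x 0 < int (card A)" using ct_bounds(2)[OF py, of 0] lx ly by simp
      moreover have "0 < \<beta> \<or> 0 < ct x k" using False True nn unfolding \<beta>_def by linarith
      moreover have "0 < \<beta> \<Longrightarrow> 0 < \<beta> * (int (card A) - ct x 0)" if "ct x 0 < int (card A)"
        using that by (intro mult_pos_pos) auto
      moreover have "0 \<le> \<beta> * (int (card A) - ct x 0)" if "ct x 0 < int (card A)"
        using that True by (intro mult_nonneg_nonneg) auto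
      moreover have "0 \<le> \<alpha> * ct x k" "0 < ct x k \<Longrightarrow> 0 < \<alpha> * ct x k" using \<alpha> nn by simp_all
      ultimately have "0 < \<beta> * (int (card A) - ct x 0) + \<alpha> * ct x k" by linarith
      then have "?T (\<lambda>_. 0) < ?T x" using k3 unfolding tilt_def ct_const by (simp add: algebra_simps)
      then show ?thesis by (intro exI[of _ 0]) simp
    next
      case False
      then have "0 < ct x k" using nn unfolding \<beta>_def by linarith
      then have "0 < \<alpha> * ct x k" using \<alpha> by simp
      moreover have "0 \<le> (- \<beta>) * ct x 0" using False nn by (intro mult_nonneg_nonneg) auto
      ultimately have "?T (\<lambda>_. k') < ?T x" using k' unfolding tilt_def ct_const by simp
      then show ?thesis using k' by blast
    qed
    then obtain i where i: "i < 3" "?T (\<lambda>_. i) < ?T x" by blast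
    define y0 :: "'a \<Rightarrow> nat" where "y0 = (\<lambda>_. i)"
    have "sum (?W y0) A < 0" using i(2) tilt_sum[of \<alpha> \<beta> k x y0] unfolding y0_def by simp
    then obtain js where J: "alt_cycle x (switch x y0 (set js)) js" "sum_list (map (?W y0) js) < 0"
      using neg_cycle[OF px, of y0] perfect_const[OF i(1)] unfolding y0_def by blast
    have dC: "distinct cs" "set cs \<subseteq> A" and dJ: "distinct js" "set js \<subseteq> A"
      using C J unfolding alt_cycle_def by auto
    show ?thesis
    proof (cases "set js \<inter> set cs = {}")
      case True
      define z w where "z = switch x y0 (set js)" and "w = switch y z (set js)"
      have Jz: "alt_cycle x z js" using J(1) unfolding z_def .
      have pz: "perfect z" using alt_cycle_perfect[OF px Jz] .
      have Tz: "?T z < ?T x" unfolding z_def tilt_switch[OF dJ] using J(2) by simp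
      have yJ: "\<And>a. a \<in> set js \<Longrightarrow> y a = x a" using C True unfolding alt_cycle_def by auto
      have e: "map (tilt_wt \<alpha> \<beta> k y z) js = map (?W y0) js"
        using yJ by (auto simp: tilt_wt_def z_def switch_def)
      have Tw: "?T w < ?T x" unfolding w_def tilt_switch[OF dJ] e using J(2) Ty by simp
      have Jw: "alt_cycle y w js" unfolding w_def by (rule alt_cycle_disjoint[OF Jz C True])
      have "switch z y (set cs) = w" using C Jz True unfolding w_def alt_cycle_def by (auto simp: switch_def fun_eq_iff)
      then have Cw: "alt_cycle z w cs" using alt_cycle_disjoint[OF C Jz] True by auto
      have pw: "perfect w" using alt_cycle_perfect[OF py Jw] .
      note sq = px C Jz True w_def lx ly
      have zw: "ct z 0 - ct x 0 = ct w 0 - ct y 0"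
      proof -
        have "ct z 0 = ct x 0 + sum_list (map (\<lambda>a. of_bool (y0 a = 0) - of_bool (x a = 0)) js)"
          unfolding z_def by (rule ct_switch[OF dJ])
        moreover have e: "map (\<lambda>a. of_bool (z a = 0) - of_bool (y a = 0)) js
            = (map (\<lambda>a. of_bool (y0 a = 0) - of_bool (x a = 0)) js :: int list)"
          using yJ by (auto simp: z_def switch_def)
        have "ct w 0 = ct y 0 + sum_list (map (\<lambda>a. of_bool (y0 a = 0) - of_bool (x a = 0)) js)"
          unfolding w_def ct_switch[OF dJ] e ..
        ultimately show ?thesis by simp
      qed
      \<comment> \<open>By \<open>zw\<close> and \<open>ct x 0 < ct y 0\<close>, also
        \<open>ct z 0 < ct w 0\<close>, which excludes the fourth combination.\<close>
      consider "ct z 0 \<le> t" "t < ct w 0" | "t < ct z 0" "t < ct w 0" | "ct z 0 \<le> t" "ct w 0 \<le> t"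
        using zw lx ly by linarith
      then show ?thesis
      proof cases
        case 1
        have "ok z w cs" unfolding ok_def using pz Cw 1 sq1[OF sq 1 Ph] by auto
        then show ?thesis using less Tz Tw by force
      next
        case 2
        have "ok x z js" unfolding ok_def using px Jz lx 2 sq2[OF sq 2 Ph] by auto
        then show ?thesis using less Tz by force
      next
        case 3
        have "ok w y (rev js)" unfolding ok_def using pw alt_cycle_rev[OF Jw] ly 3 sq3[OF sq 3 Ph] by auto
        then show ?thesis using less Tw Ty by force
      qed
    next
      case False
      have "switch x y (set cs) = y" using alt_cycle_switch[OF C] .
      then have "sum_list (map (?W y) cs) = 0" using tilt_switch[OF dC, of \<alpha> \<beta> k x y] Ty by simp
      moreover have "map (?W (switch x y0 (set js))) js = map (?W y0) js" by (auto simp: tilt_wt_def switch_def)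
      then have "sum_list (map (?W (switch x y0 (set js))) js) < 0" using J(2) by metis
      ultimately obtain us vs Q r Cs Es z where e: "cs = us @ vs" "vs @ us = Q @ r # Cs" "theta x y z Q r Cs Es"
        "\<forall>a\<in>set (r # Es). z a = switch x y0 (set js) a" "sum_list (map (?W y) Q) + sum_list (map (?W (switch x y0 (set js))) (r # Es)) < 0"
        using neg_ear[OF C J(1) False, of "?W y" "?W (switch x y0 (set js))"] by blast
      have Jz: "alt_cycle x z (Q @ r # Es)" and Qy: "\<forall>a\<in>set Q. y a = z a" using e(3) unfolding theta_def by auto
      have pz: "perfect z" using alt_cycle_perfect[OF px Jz] .
      have e': "map (?W z) (Q @ r # Es) = map (?W y) Q @ map (?W (switch x y0 (set js))) (r # Es)"
        using Qy e(4) by (auto simp: tilt_wt_def)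
      have "?T z = ?T x + sum_list (map (?W z) (Q @ r # Es))"
        using tilt_switch[of "Q @ r # Es" \<alpha> \<beta> k x z] alt_cycle_switch[OF Jz] Jz unfolding alt_cycle_def by auto
      then have Tz: "?T z < ?T x" unfolding e' using e(5) by simp
      have Ph': "\<Phi> x y (Q @ r # Cs)" using rot[OF px, of y us vs] C Ph e(1,2) by simp
      show ?thesis
      proof (cases "t < ct z 0")
        case True
        have "ok x z (Q @ r # Es)" unfolding ok_def using px Jz lx True th_hi[OF px e(3) lx ly True Ph'] by auto
        then show ?thesis using less Tz by force
      next
        case False
        then have lz: "ct z 0 \<le> t" by simp
        have "ok z y (rev (rev Cs @ r # Es))"
          unfolding ok_def using pz alt_cycle_rev[OF theta_third_cycle[OF e(3)]] lz ly th_lo[OF px e(3) lx ly lz Ph'] by auto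
        then show ?thesis using less Tz Ty by force
      qed
    qed
  qed
qed

section \<open>Pairs across the threshold and the Sperner labelling\<close>

text \<open>Among the matchings with at most \<open>t\<close> edges of color \<open>0\<close>, one
  with the most such edges is improved by some alternating cycle towards the matching of color
  \<open>0\<close>; by maximality the result exceeds \<open>t\<close>.\<close>

lemma crossing_exists:
  assumes "0 \<le> t" "t < int (card A)"
  shows "\<exists>x y cs. perfect x \<and> alt_cycle x y cs \<and> ct x 0 \<le> t \<and> t < ct y 0"
proof -
  let ?P = "\<lambda>x. perfect x \<and> ct x 0 \<le> t"
  have "?P (\<lambda>_. 1)" using perfect_const[of 1] assms(1) by (simp add: ct_const)
  moreover have "\<forall>x. ?P x \<longrightarrow> nat (ct x 0) < Suc (card A)"
    using ct_bounds(2)[of _ 0] by fastforce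
  ultimately obtain x where x: "?P x" "\<And>y. ?P y \<Longrightarrow> nat (ct y 0) \<le> nat (ct x 0)"
    using ex_has_greatest_nat[of ?P _ "\<lambda>x. nat (ct x 0)" "Suc (card A)"] by blast
  let ?w = "\<lambda>a. of_bool (x a = 0) - 1 :: int"
  have "sum ?w A = ct x 0 - int (card A)" unfolding color_count_def by (simp add: sum_subtractf)
  then have "sum ?w A < 0" using x(1) assms(2) by simp
  then obtain J where J: "alt_cycle x (switch x (\<lambda>_. 0) (set J)) J" "sum_list (map ?w J) < 0"
    using neg_cycle[of x "\<lambda>_. 0" ?w] x(1) perfect_const[of 0] by auto
  let ?y = "switch x (\<lambda>_. 0) (set J)"
  have "distinct J" "set J \<subseteq> A" using J(1) unfolding alt_cycle_def by auto
  then have "ct ?y 0 = ct x 0 + sum_list (map (\<lambda>a. of_bool (0 = (0::nat)) - of_bool (x a = 0)) J)" by (rule ct_switch)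
  moreover have "sum_list (map (\<lambda>a. of_bool (0 = (0::nat)) - of_bool (x a = 0)) J) = - sum_list (map ?w J)"
    by (induction J) auto
  ultimately have "ct x 0 < ct ?y 0" using J(2) by simp
  moreover have "perfect ?y" using alt_cycle_perfect J(1) x(1) by blast
  ultimately have "t < ct ?y 0" using x(2)[of ?y] color_count_nonneg[of A x 0] by fastforce
  then show ?thesis using x(1) J(1) by blast
qed

text \<open>A vertex at which two of the matchings agree contributes at most \<open>2\<close>, since
  \<open>i\<close>, \<open>j\<close>, \<open>l\<close> are distinct; the exceptional vertex
  \<open>r\<close> contributes at most \<open>3\<close>.\<close>

lemma rainbow_count:
  assumes "\<And>a. a \<in> A \<Longrightarrow> a \<noteq> r \<Longrightarrow> x a = y a \<or> y a = z a \<or> x a = z a" "i \<noteq> j" "j \<noteq> l" "i \<noteq> l"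
  shows "ct x i + ct y j + ct z l \<le> 2 * int (card A) + 1"
proof -
  have "ct x i + ct y j + ct z l = (\<Sum>a\<in>A. of_bool (x a = i) + of_bool (y a = j) + of_bool (z a = l))"
    unfolding color_count_def by (simp add: sum.distrib)
  also have "\<dots> \<le> (\<Sum>a\<in>A. 2 + of_bool (a = r))"
    by (rule sum_mono) (use assms in fastforce)
  also have "\<dots> \<le> 2 * int (card A) + 1"
    using fin by (simp add: sum.distrib of_bool_def sum.delta)
  finally show ?thesis .
qed

text \<open>\<open>y\<close> and \<open>z\<close> agree on \<open>Q\<close>, \<open>x\<close> and
  \<open>z\<close> on \<open>Cs\<close>, \<open>x\<close> and \<open>y\<close> on \<open>Es\<close>;
  three different colors can meet only at \<open>r\<close>.\<close>

lemma theta_agree: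
  assumes "theta x y z Q r Cs Es" "a \<noteq> r"
  shows "x a = y a \<or> y a = z a \<or> x a = z a"
proof -
  have c: "alt_cycle x y (Q @ r # Cs)" "alt_cycle x z (Q @ r # Es)" "\<forall>a\<in>set Q. y a = z a" "set Cs \<inter> set Es = {}"
    using assms(1) unfolding theta_def by auto
  have "\<forall>a. a \<notin> set (Q @ r # Cs) \<longrightarrow> y a = x a" "\<forall>a. a \<notin> set (Q @ r # Es) \<longrightarrow> z a = x a"
    using c(1,2) unfolding alt_cycle_def by auto
  then have yx: "a \<notin> set (Q @ r # Cs) \<Longrightarrow> y a = x a" and zx: "a \<notin> set (Q @ r # Es) \<Longrightarrow> z a = x a"
    by blast+
  show ?thesis
  proof (cases "a \<in> set Q")
    case True
    then show ?thesis using c(3) by blast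
  next
    case Q: False
    show ?thesis
    proof (cases "a \<in> set Cs")
      case True
      then have "a \<notin> set Es" using c(4) by blast
      then show ?thesis using zx Q assms(2) by simp
    next
      case False
      then show ?thesis using yx Q assms(2) by simp
    qed
  qed
qed

text \<open>
  A matching with at most \<open>\<beta> 0\<close> edges of color \<open>0\<close> is labelled by a color that it uses too often. Descending with a fixed label
  works because three matchings with all three labels in one theta graph or square would violate \<open>rainbow_count\<close>.
\<close>

lemma balanced_perfect_matching:
  fixes \<beta> :: "nat \<Rightarrow> int"
  assumes nonneg: "\<And>i. 0 \<le> \<beta> i" and sum: "2 * int (card A) - 1 \<le> \<beta> 0 + \<beta> 1 + \<beta> 2"
  shows "\<exists>x. perfect x \<and> (\<forall>i<3. ct x i \<le> \<beta> i)"
proof (rule ccontr)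
  assume no: "\<not> ?thesis"
  have lab: "\<beta> 1 < ct x 1 \<or> \<beta> 2 < ct x 2" if x: "perfect x" "ct x 0 \<le> \<beta> 0" for x
  proof -
    obtain i where i: "i < 3" "\<beta> i < ct x i" using no x(1) by force
    then have "i = 1 \<or> i = 2" using x(2) by (cases i) auto
    then show ?thesis using i(2) by auto
  qed
  have "\<beta> 0 < int (card A)"
  proof (rule ccontr)
    assume "\<not> \<beta> 0 < int (card A)"
    then have "\<forall>i<3. ct (\<lambda>_. 0) i \<le> \<beta> i" using nonneg by (auto simp: ct_const)
    then show False using no perfect_const[of 0] by auto
  qed
  then obtain x y cs where s: "perfect x" "alt_cycle x y cs" "ct x 0 \<le> \<beta> 0" "\<beta> 0 < ct y 0"
    using crossing_exists[of "\<beta> 0"] nonneg by blast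
  define k where "k = (if \<beta> 1 < ct x 1 then 1 else 2 :: nat)"
  define k' where "k' = 3 - k"
  have k: "k = 1 \<or> k = 2" unfolding k_def by auto
  have k': "k' \<noteq> 0" "k \<noteq> 0" "k' \<noteq> k" using k unfolding k'_def by auto
  have sumk: "2 * int (card A) - 1 \<le> \<beta> 0 + \<beta> k + \<beta> k'" using sum k unfolding k'_def by auto
  have start: "\<beta> k < ct x k" using lab[OF s(1,3)] unfolding k_def by auto
  \<comment> \<open>If \<open>z\<close> did not have label \<open>k\<close>, then \<open>x\<close>,
    \<open>y\<close>, \<open>z\<close> would each exceed their bound by at least one in three
    different colors, \<open>2 * card A + 2\<close> in total, one more than
    \<open>rainbow_count\<close> permits.\<close>
  have same: "\<beta> k < ct z k" if z: "perfect z" "ct z 0 \<le> \<beta> 0" and xy: "\<beta> k < ct x k" "\<beta> 0 < ct y 0"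
    and ag: "\<And>a. a \<in> A \<Longrightarrow> a \<noteq> r \<Longrightarrow> x a = y a \<or> y a = z a \<or> x a = z a" for x y z r
  proof (rule ccontr)
    assume n: "\<not> \<beta> k < ct z k"
    then have "\<beta> k' < ct z k'" using lab[OF z] k unfolding k'_def by auto
    moreover have "ct x k + ct y 0 + ct z k' \<le> 2 * int (card A) + 1"
      by (rule rainbow_count[OF ag]) (use k' in auto)
    ultimately show False using xy sumk by linarith
  qed
  have "\<exists>x y cs. perfect x \<and> alt_cycle x y cs \<and> ct x 0 \<le> \<beta> 0 \<and> \<beta> 0 < ct y 0 \<and> \<beta> k < ct x k \<and> ct x k = 0 \<and> ct y k = 0"
  proof (rule descent[where \<Phi> = "\<lambda>x y cs. \<beta> k < ct x k" and t = "\<beta> 0", OF k])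
    fix x y z Q r Cs Es
    assume a: "perfect x" "theta x y z Q r Cs Es" "\<beta> 0 < ct y 0" "ct z 0 \<le> \<beta> 0" "\<beta> k < ct x k"
    have "perfect z" using a(1,2) alt_cycle_perfect unfolding theta_def by blast
    then show "\<beta> k < ct z k" by (rule same[OF _ a(4,5,3)]) (use theta_agree[OF a(2)] in blast)
  next
    fix x y z w :: "'a \<Rightarrow> nat" and cs js
    assume a: "perfect x" "alt_cycle x y cs" "alt_cycle x z js" "set js \<inter> set cs = {}" "\<beta> 0 < ct y 0" "ct z 0 \<le> \<beta> 0" "\<beta> k < ct x k"
    have "perfect z" using a(1,3) alt_cycle_perfect by blast
    moreover have "x a = y a \<or> x a = z a" for a
      using a(2-4) unfolding alt_cycle_def by (metis disjoint_iff)
    ultimately show "\<beta> k < ct z k" using same[OF _ a(6,7,5)] by blast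
  next
    fix x y z w :: "'a \<Rightarrow> nat" and cs js
    assume a: "perfect x" "alt_cycle x y cs" "alt_cycle x z js" "set js \<inter> set cs = {}" "w = switch y z (set js)"
      "\<beta> 0 < ct y 0" "ct w 0 \<le> \<beta> 0" "\<beta> k < ct x k"
    have "alt_cycle y w js" unfolding a(5) by (rule alt_cycle_disjoint[OF a(3,2,4)])
    then have "perfect w" using alt_cycle_perfect[OF alt_cycle_perfect[OF a(1,2)]] by blast
    moreover have "x a = y a \<or> y a = w a" for a
      using a(2-5) unfolding alt_cycle_def switch_def by (metis disjoint_iff)
    ultimately show "\<beta> k < ct w k" using same[OF _ a(7,8,6)] by blast
  qed (use s start in auto)
  then show False using nonneg[of k] by auto
qed

end

section \<open>Crossing numbers in connected graphs\<close>

context unhit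
begin

lemma winding_reverse: "alt_cycle x y as \<Longrightarrow> winding y x (rev as) = - winding x y as"
  using winding_rev[of as x y] alt_cycle_switch[of x y as] unfolding alt_cycle_def by simp

text \<open>Connectivity supplies a path between the two cycles; both are rotated to start at its
  ends, which gives the situation of \<open>winding_dumbbell\<close>.\<close>

lemma winding_square:
  assumes indecomposable "perfect x" and C: "alt_cycle x y cs" and J: "alt_cycle x z js" and d: "set js \<inter> set cs = {}"
    and w: "w = switch y z (set js)"
  shows "alt_cycle z w cs" "alt_cycle y w js" "winding x z js + winding z w cs = winding x y cs + winding y w js"
proof -
  show Jw: "alt_cycle y w js" unfolding w by (rule alt_cycle_disjoint[OF J C d])
  have "switch z y (set cs) = w" using C J d unfolding w alt_cycle_def by (auto simp: switch_def fun_eq_iff)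
  then show Cw: "alt_cycle z w cs" using alt_cycle_disjoint[OF C J] d by auto
  have ne: "set cs \<noteq> {}" "set cs \<subseteq> A" "set js \<noteq> {}" "set js \<subseteq> A" "set cs \<inter> set js = {}"
    using C J d unfolding alt_cycle_def by auto
  obtain a ps h q where P: "a \<in> set cs" "h \<in> set js" "distinct ps" "set ps \<subseteq> A" "set ps \<inter> (set cs \<union> set js) = {}"
    "\<forall>b\<in>set (a # ps). q b < 3" "successively (arc x q) (a # ps @ [h])"
    using join_path[OF assms(1,2) ne] by metis
  obtain c1 c2 where c: "cs = c1 @ a # c2" using P(1) split_list by metis
  obtain j1 j2 where j: "js = j1 @ h # j2" using P(2) split_list by metis
  have C': "alt_cycle x y (a # c2 @ c1)" using alt_cycle_rotate[of x y c1 "a # c2"] C c by simp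
  have J': "alt_cycle x z (h # j2 @ j1)" using alt_cycle_rotate[of x z j1 "h # j2"] J j by simp
  have sets: "set (h # j2 @ j1) = set js" "set (a # c2 @ c1) = set cs" using c j by auto
  have "winding x z (h # j2 @ j1) + winding z (switch y z (set (h # j2 @ j1))) (a # c2 @ c1)
    = winding x y (a # c2 @ c1) + winding y (switch y z (set (h # j2 @ j1))) (h # j2 @ j1)"
    by (rule winding_dumbbell[OF assms(2) J' C' _ P(3,4) _ P(6,7)]) (use P(5) d sets in blast)+
  then have eq: "winding x z (h # j2 @ j1) + winding z w (a # c2 @ c1) = winding x y (a # c2 @ c1) + winding y w (h # j2 @ j1)"
    unfolding sets(1) w .
  have "winding x z js = winding x z (h # j2 @ j1)" "winding y w js = winding y w (h # j2 @ j1)"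
    using winding_rotate[of _ _ j1 "h # j2"] assms(2) J Jw alt_cycle_perfect[OF assms(2) C] j by auto
  moreover have "winding x y cs = winding x y (a # c2 @ c1)" "winding z w cs = winding z w (a # c2 @ c1)"
    using winding_rotate[of _ _ c1 "a # c2"] assms(2) C Cw alt_cycle_perfect[OF assms(2) J] c by auto
  ultimately show "winding x z js + winding z w cs = winding x y cs + winding y w js" using eq by simp
qed

text \<open>Points of the ray have more than \<open>s\<close>, hence a positive number of edges of
  color \<open>k\<close>, while the walk never uses this color.\<close>

lemma winding_unused_color:
  assumes "k < 3" "set as \<subseteq> A" "\<forall>a\<in>A. x a \<noteq> k \<and> y a \<noteq> k"
  shows "winding x y as = 0"
  using assms(2,3)
proof (induction as arbitrary: x)
  case (Cons a as)
  have "ct (x(a := 3)) k = 0"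
    unfolding color_count_def
    by (rule sum.neutral) (use Cons.prems(2) assms(1) in \<open>auto simp: fun_upd_apply\<close>)
  then have "right_of (x(a := 3)) = 0" unfolding right_of_def using s0 by simp
  moreover have "winding (x(a := y a)) y as = 0"
    by (rule Cons.IH) (use Cons.prems in \<open>auto simp: fun_upd_apply\<close>)
  ultimately show ?case by simp
qed simp

text \<open>A nonzero number would survive every move of \<open>descent\<close>: in the theta graph
  and in the square, the cycles whose ends lie on one side of the threshold contribute
  \<open>0\<close>. It would reach a pair without color \<open>k\<close>, where the number is
  \<open>0\<close>.\<close>

lemma winding_crossing:
  assumes indecomposable and k: "k = 1 \<or> k = 2" and s: "perfect x" "alt_cycle x y cs" "ct x 0 \<le> t" "t < ct y 0"
  shows "winding x y cs = 0"
proof (rule ccontr)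
  assume nz: "winding x y cs \<noteq> 0"
  have "\<exists>x y cs. perfect x \<and> alt_cycle x y cs \<and> ct x 0 \<le> t \<and> t < ct y 0 \<and> winding x y cs \<noteq> 0 \<and> ct x k = 0 \<and> ct y k = 0"
  proof (rule descent[where \<Phi> = "\<lambda>x y cs. winding x y cs \<noteq> 0" and t = t, OF k])
    fix x y us vs assume "perfect x" "alt_cycle x y (us @ vs)" "winding x y (us @ vs) \<noteq> 0"
    then show "winding x y (vs @ us) \<noteq> 0" using winding_rotate by metis
  next
    fix x y z Q r Cs Es
    assume a: "perfect x" "theta x y z Q r Cs Es" "ct x 0 \<le> t" "t < ct y 0" "t < ct z 0" "winding x y (Q @ r # Cs) \<noteq> 0"
    have "perfect y" using a(1,2) alt_cycle_perfect unfolding theta_def by blast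
    then show "winding x z (Q @ r # Es) \<noteq> 0"
      using winding_theta[OF a(2)] winding_above[OF _ theta_third_cycle[OF a(2)] a(4,5)] a(6) by simp
  next
    fix x y z Q r Cs Es
    assume a: "perfect x" "theta x y z Q r Cs Es" "ct x 0 \<le> t" "t < ct y 0" "ct z 0 \<le> t" "winding x y (Q @ r # Cs) \<noteq> 0"
    have "alt_cycle x z (Q @ r # Es)" using a(2) unfolding theta_def by blast
    then show "winding z y (rev (rev Cs @ r # Es)) \<noteq> 0"
      using winding_theta[OF a(2)] winding_below[OF a(1) _ a(3,5)] winding_reverse[OF theta_third_cycle[OF a(2)]] a(6) by simp
  next
    fix x y z w cs js
    assume a: "perfect x" "alt_cycle x y cs" "alt_cycle x z js" "set js \<inter> set cs = {}" "w = switch y z (set js)"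
      "ct x 0 \<le> t" "t < ct y 0" "winding x y cs \<noteq> 0"
    note sq = winding_square[OF assms(1) a(1-5)]
    have py: "perfect y" and pz: "perfect z" using alt_cycle_perfect a(1-3) by blast+
    show "winding z w cs \<noteq> 0" if "ct z 0 \<le> t" "t < ct w 0"
      using sq(3) winding_below[OF a(1,3,6) that(1)] winding_above[OF py sq(2) a(7) that(2)] a(8) by simp
    show "winding x z js \<noteq> 0" if "t < ct z 0" "t < ct w 0"
      using sq(3) winding_above[OF pz sq(1) that] winding_above[OF py sq(2) a(7) that(2)] a(8) by simp
    show "winding w y (rev js) \<noteq> 0" if "ct z 0 \<le> t" "ct w 0 \<le> t"
      using sq(3) winding_below[OF a(1,3,6) that(1)] winding_below[OF pz sq(1) that] winding_reverse[OF sq(2)] a(8) by simp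
  qed (use s nz in auto)
  then obtain x y cs where e: "alt_cycle x y cs" "winding x y cs \<noteq> 0" "ct x k = 0" "ct y k = 0" by blast
  have "\<forall>a\<in>A. x a \<noteq> k \<and> y a \<noteq> k"
    using e(3,4) fin unfolding color_count_card[OF fin] by auto
  then have "winding x y cs = 0" using winding_unused_color e(1) k unfolding alt_cycle_def by auto
  then show False using e(2) by simp
qed

end

context three_matchings
begin

text \<open>The two rays fill the line of vectors with \<open>t\<close> edges of color
  \<open>0\<close> except for the target. Together they count net passages from level
  \<open>t\<close> to level \<open>t + 1\<close>, so the partial sum tells whether the current
  matching is above \<open>t\<close>.\<close>

lemma winding_total:
  assumes "unhit A B p t s1 i" "unhit A B p t s2 j" and ij: "{i, j} = {1, 2}"
    and n: "t + s1 + s2 + 1 = int (card A)"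
    and "perfect x" "alt_cycle x y cs" "ct x 0 \<le> t" "t < ct y 0"
  shows "unhit.winding A t s1 i x y cs + unhit.winding A t s2 j x y cs = 1"
proof -
  interpret U1: unhit A B p t s1 i by (rule assms(1))
  interpret U2: unhit A B p t s2 j by (rule assms(2))
  have sum_ij: "ct f i + ct f j = ct f 1 + ct f 2" for f using ij by (auto simp: doubleton_eq_iff)
  have c: "distinct cs" "set cs \<subseteq> A" "\<forall>a\<in>set cs. x a < 3 \<and> y a < 3" "successively (arc x y) (cs @ [hd cs])"
    using assms(6) unfolding alt_cycle_def by auto
  have "U1.winding x y ws + U2.winding x y ws = of_bool (t < ct (switch x y (set ws)) 0)" if "\<exists>zs. cs = ws @ zs" for ws
    using that
  proof (induction ws rule: rev_induct)
    case Nil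
    then show ?case using assms(7) by simp
  next
    case (snoc a ws)
    then obtain zs where zs: "cs = ws @ a # zs" by auto
    let ?g = "switch x y (set ws)"
    let ?f = "?g(a := 3)"
    have a: "a \<in> A" "a \<notin> set ws" using c(1,2) zs by auto
    have IH: "U1.winding x y ws + U2.winding x y ws = of_bool (t < ct ?g 0)" using snoc zs by auto
    have "successively (arc x y) ((ws @ [a]) @ zs @ [hd cs])" using c(4) zs by simp
    then have su: "successively (arc x y) (ws @ [a])" by (rule successively_appendD1)
    let ?os = "map (\<lambda>a. (a, y a)) (rev ws)"
    have "B_walk (x(a := 3)) (p (x a) a) ?os"
      by (rule U1.B_walk_path) (use c zs su in auto)
    from B_walk_near_perfect[OF near_perfect_remove[OF assms(5) a(1)] this] have "near_perfect (B_walk_end (x(a := 3)) ?os) a (B_walk_gap (x(a := 3)) (p (x a) a) ?os)" .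
    moreover have "B_walk_end (x(a := 3)) ?os = ?f"
      unfolding B_walk_end_map using a(2) by (auto simp: switch_def fun_upd_apply fun_eq_iff)
    ultimately obtain v where near_perfect: "near_perfect ?f a v" by auto
    \<comment> \<open>At level \<open>t\<close> the other two counts add up to
      \<open>s1 + s2\<close> and differ from \<open>s1\<close> and \<open>s2\<close>, so exactly one
      of them is too large.\<close>
    have at_level: "U1.right_of ?f + U2.right_of ?f = of_bool (ct ?f 0 = t)"
      using near_perfect_sum[OF near_perfect] sum_ij[of ?f] U1.unhit[OF near_perfect] U2.unhit[OF near_perfect] n unfolding U1.right_of_def U2.right_of_def by auto
    have g1: "switch x y (set (ws @ [a])) = ?g(a := y a)" by (simp add: switch_upd)
    have ga: "?g a = x a" using a(2) by (simp add: switch_def)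
    have ct: "ct ?f 0 = ct ?g 0 - of_bool (x a = 0)" "ct (?g(a := y a)) 0 = ct ?g 0 + of_bool (y a = 0) - of_bool (x a = 0)"
      using a(1) ga by (simp_all add: ct_upd)
    have "U1.winding x y (ws @ [a]) + U2.winding x y (ws @ [a])
      = of_bool (t < ct ?g 0) + (U1.right_of ?f + U2.right_of ?f) * (of_bool (y a = 0) - of_bool (x a = 0))"
      using IH ga by (simp add: U1.winding_append U2.winding_append algebra_simps)
    also have "\<dots> = of_bool (t < ct (?g(a := y a)) 0)"
      unfolding at_level ct by (cases "x a = 0"; cases "y a = 0") auto
    finally show ?case unfolding g1 .
  qed
  from this[of cs] show ?thesis using assms(6,8) alt_cycle_switch by auto
qed

lemma connected_case:
  fixes b :: "nat \<Rightarrow> nat"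
  assumes indecomposable and n: "b 0 + b 1 + b 2 + 1 = card A"
  shows "\<exists>f u v. near_perfect f u v \<and> (\<forall>i<3. ct f i = int (b i))"
proof (rule ccontr)
  assume no: "\<not> ?thesis"
  have no': "\<not> (ct f 0 = int (b 0) \<and> ct f i = int (b i))" if "near_perfect f u v" "i = 1 \<or> i = 2" for f u v i
  proof
    assume a: "ct f 0 = int (b 0) \<and> ct f i = int (b i)"
    have "ct f 0 = int (b 0)" "ct f 1 = int (b 1)" "ct f 2 = int (b 2)"
      using a that(2) near_perfect_sum[OF that(1)] n by auto
    moreover have "i = 0 \<or> i = 1 \<or> i = 2" if "i < 3" for i :: nat using that by auto
    ultimately show False using no that(1) by metis
  qed
  have U: "unhit A B p (int (b 0)) (int (b i)) i" if "i = 1 \<or> i = 2" for i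
    by unfold_locales (use that no' in auto)
  interpret U1: unhit A B p "int (b 0)" "int (b 1)" 1 by (rule U) simp
  interpret U2: unhit A B p "int (b 0)" "int (b 2)" 2 by (rule U) simp
  obtain x y cs where s: "perfect x" "alt_cycle x y cs" "ct x 0 \<le> int (b 0)" "int (b 0) < ct y 0"
    using crossing_exists[of "int (b 0)"] n by auto
  have "U1.winding x y cs + U2.winding x y cs = 1"
    by (rule winding_total[OF U1.unhit_axioms U2.unhit_axioms _ _ s]) (use n in simp_all)
  moreover have "U1.winding x y cs = 0" by (rule U1.winding_crossing[OF assms(1) _ s]) simp
  moreover have "U2.winding x y cs = 0" by (rule U2.winding_crossing[OF assms(1) _ s]) simp
  ultimately show False by simp
qed

text \<open>A set with the same image under all three bijections spans a union of components, and
  the colors restrict to it and to its complement.\<close>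

lemma restrict_closed:
  assumes "X \<subseteq> A" "p 0 ` X = p 1 ` X" "p 0 ` X = p 2 ` X"
  shows "three_matchings X (p 0 ` X) p" "three_matchings (A - X) (B - p 0 ` X) p"
proof -
  have im: "p i ` X = p 0 ` X" if "i < 3" for i
  proof -
    have "i = 0 \<or> i = 1 \<or> i = 2" using that by auto
    then show ?thesis using assms(2,3) by auto
  qed
  show "three_matchings X (p 0 ` X) p"
  proof
    show "finite X" using assms(1) fin finite_subset by blast
    show "bij_betw (p i) X (p 0 ` X)" if "i < 3" for i
      using bij[OF that] im[OF that] assms(1) unfolding bij_betw_def by (metis inj_on_subset)
  qed
  show "three_matchings (A - X) (B - p 0 ` X) p"
  proof
    show "finite (A - X)" using fin by simp
    show "bij_betw (p i) (A - X) (B - p 0 ` X)" if "i < 3" for i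
      unfolding im[OF that, symmetric]
      using bij[OF that] inj_on_image_set_diff[of "p i" A A X] assms(1) inj_on_subset[of "p i" A "A - X"]
      unfolding bij_betw_def by auto
  qed
qed

end

section \<open>Matchings with prescribed color vector\<close>

theorem near_perfect_matching_exact:
  fixes b :: "nat \<Rightarrow> nat"
  assumes "three_matchings A B p" "b 0 + b 1 + b 2 + 1 = card A"
  shows "\<exists>f u v. three_matchings.near_perfect A B p f u v \<and> (\<forall>i<3. color_count A f i = int (b i))"
  using assms
proof (induction "card A" arbitrary: A B b rule: less_induct)
  case less
  interpret three_matchings A B p by (rule less.prems(1))
  show ?case
  proof (cases indecomposable)
    case True
    then show ?thesis using connected_case less.prems(2) by blast
  next
    case False
    then obtain U where U: "U \<subseteq> A" "U \<noteq> {}" "U \<noteq> A" "p 0 ` U = p 1 ` U" "p 0 ` U = p 2 ` U"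
      unfolding indecomposable_def by blast
    have U0: "p 0 ` U \<subseteq> B" using U(1) p_mem by auto
    define C where "C = p 0 ` U"
    define W where "W = A - U"
    note UW = restrict_closed[OF U(1,4,5), folded C_def W_def]
    have "\<exists>X Y BX BY. three_matchings X BX p \<and> three_matchings Y BY p \<and> X \<union> Y = A \<and> X \<inter> Y = {}
      \<and> BX \<union> BY = B \<and> BX \<inter> BY = {} \<and> X \<noteq> {} \<and> card X \<le> card Y"
    proof (cases "card U \<le> card W")
      case True
      then show ?thesis using UW U U0
        by (intro exI[of _ U] exI[of _ W] exI[of _ C] exI[of _ "B - C"]) (auto simp: W_def C_def)
    next
      case False
      then show ?thesis using UW U U0
        by (intro exI[of _ W] exI[of _ U] exI[of _ "B - C"] exI[of _ C]) (auto simp: W_def C_def)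
    qed
    then obtain X Y BX BY where X: "three_matchings X BX p" and Y: "three_matchings Y BY p"
      and XY: "X \<union> Y = A" "X \<inter> Y = {}" "BX \<union> BY = B" "BX \<inter> BY = {}" "X \<noteq> {}" "card X \<le> card Y" by blast
    interpret X: three_matchings X BX p by (rule X)
    interpret Y: three_matchings Y BY p by (rule Y)
    have card: "card A = card X + card Y"
      using card_Un_disjoint[OF X.fin Y.fin XY(2)] XY(1) by simp
    have cX: "0 < card X" using XY(5) X.fin by (simp add: card_gt_0_iff)
    \<comment> \<open>The bounds \<open>b i\<close> add up to \<open>card X + card Y - 1\<close>,
      which is at least \<open>2 * card X - 1\<close> because \<open>X\<close> is the smaller
      part.\<close>
    obtain x where x: "X.perfect x" "\<forall>i<3. X.ct x i \<le> int (b i)"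
      using X.balanced_perfect_matching[of "\<lambda>i. int (b i)"] less.prems(2) XY(6) card by force
    define b' where "b' i = b i - nat (X.ct x i)" for i
    have b': "int (b' i) = int (b i) - X.ct x i" if "i < 3" for i
      using x(2) that color_count_nonneg[of X x i] unfolding b'_def by (simp add: nat_le_iff of_nat_diff)
    have "b' 0 + b' 1 + b' 2 + 1 = card Y"
      using b'[of 0] b'[of 1] b'[of 2] X.perfect_sum[OF x(1)] less.prems(2) card by simp
    then obtain f u v where f: "Y.near_perfect f u v" "\<forall>i<3. Y.ct f i = int (b' i)"
      using less.hyps[OF _ Y, of b'] card cX by auto
    let ?g = "\<lambda>a. if a \<in> X then x a else f a"
    have u: "u \<in> Y" "v \<in> BY" "u \<notin> X" "v \<notin> BX" using f(1) XY unfolding Y.near_perfect_def by auto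
    have gX: "bij_betw (\<lambda>a. p (?g a) a) X BX = bij_betw (\<lambda>a. p (x a) a) X BX"
      by (rule bij_betw_cong) simp
    have gY: "bij_betw (\<lambda>a. p (?g a) a) (Y - {u}) (BY - {v}) = bij_betw (\<lambda>a. p (f a) a) (Y - {u}) (BY - {v})"
      by (rule bij_betw_cong) (use XY(2) in auto)
    have "bij_betw (\<lambda>a. p (?g a) a) X BX" unfolding gX using x(1) unfolding X.perfect_def by simp
    moreover have "bij_betw (\<lambda>a. p (?g a) a) (Y - {u}) (BY - {v})"
      unfolding gY using f(1) unfolding Y.near_perfect_def by simp
    moreover have "BX \<inter> (BY - {v}) = {}" using XY(4) by auto
    ultimately have "bij_betw (\<lambda>a. p (?g a) a) (X \<union> (Y - {u})) (BX \<union> (BY - {v}))"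
      by (rule bij_betw_combine)
    moreover have "X \<union> (Y - {u}) = A - {u}" "BX \<union> (BY - {v}) = B - {v}" using XY u by auto
    ultimately have bg: "bij_betw (\<lambda>a. p (?g a) a) (A - {u}) (B - {v})" by metis
    have "?g a < 3" if "a \<in> A - {u}" for a
    proof (cases "a \<in> X")
      case True
      then show ?thesis using x(1) unfolding X.perfect_def by simp
    next
      case False
      then have "a \<in> Y - {u}" using that XY(1) by blast
      then show ?thesis using False f(1) unfolding Y.near_perfect_def by simp
    qed
    moreover have "?g u = 3" using u(3) f(1) unfolding Y.near_perfect_def by simp
    moreover have "u \<in> A" "v \<in> B" using u(1,2) XY(1,3) by blast+
    ultimately have "near_perfect ?g u v" unfolding near_perfect_def using bg by blast
    moreover have "ct ?g i = int (b i)" if "i < 3" for i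
    proof -
      have "ct ?g i = color_count X ?g i + color_count Y ?g i"
        unfolding color_count_def XY(1)[symmetric] by (rule sum.union_disjoint[OF X.fin Y.fin XY(2)])
      moreover have "color_count X ?g i = color_count X x i" unfolding color_count_def by (rule sum.cong) auto
      moreover have "color_count Y ?g i = color_count Y f i" unfolding color_count_def by (rule sum.cong) (use XY(2) in auto)
      ultimately show ?thesis using f(2) b' that by simp
    qed
    ultimately show ?thesis by blast
  qed
qed

section \<open>From sets of edges to bijections and back\<close>

lemma perfect_matching_bij:
  assumes pm: "perfect_matching V E M" and AB: "A \<union> B = V" "A \<inter> B = {}"
    and E: "\<forall>e\<in>E. \<exists>a\<in>A. \<exists>b\<in>B. e = {a, b}"
  shows "\<exists>g. bij_betw g A B \<and> M = (\<lambda>a. {a, g a}) ` A"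
proof -
  have M: "M \<subseteq> E" "pairwise disjnt M" "\<Union>M = V" using pm unfolding perfect_matching_def matching_def by auto
  have same: "e = e'" if "e \<in> M" "e' \<in> M" "c \<in> e" "c \<in> e'" for e e' c
    using M(2) that unfolding pairwise_def disjnt_def by blast
  have "\<forall>a\<in>A. \<exists>b. b \<in> B \<and> {a, b} \<in> M"
  proof
    fix a assume a: "a \<in> A"
    then obtain e where e: "e \<in> M" "a \<in> e" using M(3) AB(1) by auto
    obtain a' b where ab: "a' \<in> A" "b \<in> B" "e = {a', b}"
      using bspec[OF E subsetD[OF M(1) e(1)]] by auto
    then have "a = a'" using a e(2) AB(2) by blast
    then show "\<exists>b. b \<in> B \<and> {a, b} \<in> M" using ab e(1) by auto
  qed
  then obtain g where g: "\<forall>a\<in>A. g a \<in> B \<and> {a, g a} \<in> M" by metis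
  have inj: "inj_on g A"
  proof (rule inj_onI)
    fix a a' assume a: "a \<in> A" "a' \<in> A" "g a = g a'"
    have "{a, g a} \<in> M" "{a', g a'} \<in> M" "g a \<in> {a', g a'}" using a g by auto
    then have "{a, g a} = {a', g a'}" using same[of "{a, g a}" "{a', g a'}" "g a"] by blast
    moreover have "a \<notin> B" "g a' \<in> B" using a AB(2) g by blast+
    ultimately show "a = a'" unfolding doubleton_eq_iff by blast
  qed
  have edge: "\<exists>a\<in>A. e = {a, g a}" if e: "e \<in> M" for e
  proof -
    obtain a b where ab: "a \<in> A" "b \<in> B" "e = {a, b}"
      using bspec[OF E subsetD[OF M(1) e]] by auto
    have "{a, g a} \<in> M" "a \<in> e" using g ab(1,3) by blast+
    then have "e = {a, g a}" using same[of e "{a, g a}" a] e by blast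
    then show ?thesis using ab(1) by blast
  qed
  have "B \<subseteq> g ` A"
  proof
    fix b assume b: "b \<in> B"
    then obtain e where e: "e \<in> M" "b \<in> e" using M(3) AB(1) by auto
    then obtain a where "a \<in> A" "e = {a, g a}" using edge by blast
    moreover have "b \<notin> A" using b AB(2) by blast
    ultimately show "b \<in> g ` A" using e(2) by blast
  qed
  then have "bij_betw g A B" using inj g unfolding bij_betw_def by auto
  moreover have "M = (\<lambda>a. {a, g a}) ` A" using g edge by auto
  ultimately show ?thesis by blast
qed

theorem theorem1p2:
  fixes V :: "'a set" and E M1 M2 M3 :: "'a set set" and n a1 a2 a3 :: nat
  assumes "simple_graph V E"
    and "bipartite V E"
    and "card V = 2 * n"
    and "perfect_matching V E M1"
    and "perfect_matching V E M2"
    and "perfect_matching V E M3"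
    and "M1 \<inter> M2 = {}" and "M1 \<inter> M3 = {}" and "M2 \<inter> M3 = {}"
    and "E = M1 \<union> M2 \<union> M3"
    and "int a1 + int a2 + int a3 = int n - 1"
  shows "\<exists>M. typed_matching E M1 M2 M3 a1 a2 a3 M"
proof -
  obtain A B where AB: "A \<union> B = V" "A \<inter> B = {}" "\<forall>e\<in>E. \<exists>a\<in>A. \<exists>b\<in>B. e = {a, b}"
    using assms(2) unfolding bipartite_def by blast
  define Ms where "Ms = (\<lambda>i::nat. if i = 0 then M1 else if i = 1 then M2 else M3)"
  have "\<exists>g. bij_betw g A B \<and> Ms i = (\<lambda>a. {a, g a}) ` A" for i
    using perfect_matching_bij[OF _ AB] assms(4-6) unfolding Ms_def by auto
  then obtain p where p: "\<And>i. bij_betw (p i) A B" "\<And>i. Ms i = (\<lambda>a. {a, p i a}) ` A" by metis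
  have fV: "finite V" using assms(1) unfolding simple_graph_def by blast
  then have fA: "finite A" "finite B" using AB(1) by auto
  interpret three_matchings A B p by unfold_locales (use fA p in auto)
  have "card A = n" using card_Un_disjoint[OF fA AB(2)] AB(1) card_AB assms(3) by simp
  define b where "b = (\<lambda>i::nat. if i = 0 then a1 else if i = 1 then a2 else a3)"
  have "b 0 + b 1 + b 2 + 1 = card A" using assms(11) \<open>card A = n\<close> unfolding b_def by simp
  then obtain f u v where f: "near_perfect f u v" "\<forall>i<3. ct f i = int (b i)"
    using near_perfect_matching_exact[OF three_matchings_axioms, of b] by blast
  let ?e = "\<lambda>a. {a, p (f a) a}"
  let ?M = "?e ` (A - {u})"
  have f3: "\<And>a. a \<in> A - {u} \<Longrightarrow> f a < 3" and fu: "f u = 3" and inj: "inj_on (\<lambda>a. p (f a) a) (A - {u})"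
    using f(1) unfolding near_perfect_def bij_betw_def by auto
  have pB: "p i a \<in> B" if "a \<in> A" for i a using p(1)[of i] that bij_betwE by blast
  \<comment> \<open>Disjointness makes the color of an edge unique, so that counting vertices of
    \<open>A\<close> by color counts edges by matching.\<close>
  have Msdisj: "Ms i \<inter> Ms j = {}" if "i \<noteq> j" "i < 3" "j < 3" for i j
  proof -
    have "i = 0 \<or> i = 1 \<or> i = 2" "j = 0 \<or> j = 1 \<or> j = 2" using that by auto
    then show ?thesis using assms(7-9) that(1) unfolding Ms_def by auto
  qed
  have eMs: "?e a \<in> Ms (f a)" if "a \<in> A" for a using p(2)[of "f a"] that by auto
  have "Ms i \<subseteq> E" for i using assms(10) unfolding Ms_def by auto
  then have "?M \<subseteq> E" using eMs by blast
  moreover have "pairwise disjnt ?M"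
  proof (rule pairwiseI)
    fix e e' assume e: "e \<in> ?M" "e' \<in> ?M" "e \<noteq> e'"
    then obtain a a' where a: "a \<in> A - {u}" "a' \<in> A - {u}" "e = ?e a" "e' = ?e a'" by auto
    then have "a \<noteq> a'" using e(3) by auto
    then have "p (f a) a \<noteq> p (f a') a'" using inj a(1,2) unfolding inj_on_def by blast
    then show "disjnt e e'" using \<open>a \<noteq> a'\<close> a pB AB(2) unfolding disjnt_def by auto
  qed
  moreover have "card (?M \<inter> Ms i) = b i" if i: "i < 3" for i
  proof -
    have "?M \<inter> Ms i = ?e ` {a \<in> A. f a = i}"
    proof
      show "?M \<inter> Ms i \<subseteq> ?e ` {a \<in> A. f a = i}"
      proof
        fix e assume e: "e \<in> ?M \<inter> Ms i"
        then obtain a where a: "a \<in> A - {u}" "e = ?e a" by auto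
        have "f a = i" using Msdisj[OF _ f3[OF a(1)] i] eMs[of a] e a by auto
        then show "e \<in> ?e ` {a \<in> A. f a = i}" using a by auto
      qed
      show "?e ` {a \<in> A. f a = i} \<subseteq> ?M \<inter> Ms i" using eMs fu i by auto
    qed
    moreover have "inj_on ?e {a \<in> A. f a = i}"
      using pB AB(2) by (auto simp: inj_on_def doubleton_eq_iff)
    ultimately have "card (?M \<inter> Ms i) = card {a \<in> A. f a = i}" by (simp only: card_image)
    then show ?thesis using f(2) i color_count_card[OF fin, of f i] by simp
  qed
  ultimately have "typed_matching E M1 M2 M3 a1 a2 a3 ?M"
    unfolding typed_matching_def matching_def
    using \<open>\<And>i. i < 3 \<Longrightarrow> card (?M \<inter> Ms i) = b i\<close>[of 0] \<open>\<And>i. i < 3 \<Longrightarrow> card (?M \<inter> Ms i) = b i\<close>[of 1]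
      \<open>\<And>i. i < 3 \<Longrightarrow> card (?M \<inter> Ms i) = b i\<close>[of 2]
    unfolding Ms_def b_def by simp
  then show ?thesis by blast
qed

end
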